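(* Let $m,n\ge 1$ and let $K_{m,n}$ be the complete bipartite graph with parts of sizes $m$ and $n$. Fix any total ordering of $E(K_{m,n})$ and any field $\Bbbk$. Then $$h_{K_{m,n}}(z)=\sum_{k=1}^{m}(-1)^{m+k}\left\{{m\atop k}\right\} z^{m-k}\left(\prod_{a=1}^{k-2}(1+az)\right)(1+(k-1)z)^n,$$ with the empty product interpreted as $1$, and $$\mathrm{Hilb}(\Bbbk[\mathrm{BC}(K_{m,n})];z)=\frac{h_{K_{m,n}}(z)}{(1-z)^{m+n-1}}.$$
   Context: $\left\{{m\atop k}\right\}$ denotes the Stirling number of the second kind (the number of partitions of an $m$-element set into $k$ nonempty blocks). For a finite connected loopless graph $G$ with a fixed total order on $E(G)$, a broken circuit is a set $C\setminus\{\max C\}$, where $C$ is the edge set of a cycle of $G$ and $\max C$ is its largest edge. The broken-circuit complex $\mathrm{BC}(G)$ is the simplicial complex on $E(G)$ whose faces are the edge sets containing no broken circuit. Its Stanley--Reisner ring is $\Bbbk[\mathrm{BC}(G)]=\Bbbk[x_e:e\in E(G)]/I_{\mathrm{BC}(G)}$, with $I_{\mathrm{BC}(G)}$ generated by the monomials $\prod_{e\in C\setminus\{\max C\}}x_e$ over all cycles $C$ of $G$; it is graded by $\deg x_e=1$, and $\mathrm{Hilb}$ denotes its Hilbert series. With $r=|V(G)|-1$ and $b_i$ the number of faces of $\mathrm{BC}(G)$ having exactly $i$ elements, the $h$-polynomial of $\mathrm{BC}(G)$ is $h_G(z)=\sum_{i=0}^{r}b_i z^i(1-z)^{r-i}$.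 *)

theory Defs
  imports
    "HOL-Algebra.QuotRing"
    "HOL-Algebra.Embedded_Algebras"
    "HOL-Library.Poly_Mapping"
    "HOL-Computational_Algebra.Polynomial_FPS"
    "HOL-Combinatorics.Stirling"
begin

section \<open>Graphs and broken circuits\<close>

text \<open>An undirected loopless graph, possibly with parallel edges: \<open>ends e\<close> is the set of the
  two end vertices of the edge \<open>e\<close>.\<close>

record ('v, 'e) ugraph =
  verts :: "'v set"
  edges :: "'e set"
  ends :: "'e \<Rightarrow> 'v set"

text \<open>Two distinct parallel edges form a cycle of length 2; in a simple graph the distinctness of
  the edges forces cycles to have length at least 3.\<close>

definition is_cycle :: "('v, 'e) ugraph \<Rightarrow> 'e set \<Rightarrow> bool" where
  "is_cycle G C \<longleftrightarrow> (\<exists>vs es. length vs = length es \<and> 2 \<le> length es \<and>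
     distinct vs \<and> distinct es \<and> set vs \<subseteq> verts G \<and> set es \<subseteq> edges G \<and>
     (\<forall>i < length es. ends G (es ! i) = {vs ! i, vs ! (Suc i mod length es)}) \<and>
     C = set es)"

text \<open>The total order on the edges is a relation \<open>r\<close>, where \<open>(f, e) \<in> r\<close> means
  \<open>f \<le> e\<close>; below, \<open>e\<close> is thus the largest edge of the cycle.\<close>

definition broken_circuits :: "('v, 'e) ugraph \<Rightarrow> 'e rel \<Rightarrow> 'e set set" where
  "broken_circuits G r =
     {C - {e} | C e. is_cycle G C \<and> e \<in> C \<and> (\<forall>f\<in>C. (f, e) \<in> r)}"

definition bc_complex :: "('v, 'e) ugraph \<Rightarrow> 'e rel \<Rightarrow> 'e set set" where
  "bc_complex G r = {F. F \<subseteq> edges G \<and> (\<forall>B\<in>broken_circuits G r. \<not> B \<subseteq> F)}"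

definition h_poly :: "('v, 'e) ugraph \<Rightarrow> 'e rel \<Rightarrow> int poly" where
  "h_poly G r =
     (let d = card (verts G) - 1 in
      \<Sum>i\<le>d. of_nat (card {F \<in> bc_complex G r. card F = i}) * monom 1 i * [:1, - 1:] ^ (d - i))"

definition complete_bipartite :: "nat \<Rightarrow> nat \<Rightarrow> (nat + nat, nat \<times> nat) ugraph" where
  "complete_bipartite m n =
     \<lparr>verts = Inl ` {..<m} \<union> Inr ` {..<n},
      edges = {..<m} \<times> {..<n},
      ends = (\<lambda>(i, j). {Inl i, Inr j})\<rparr>"

section \<open>The Stanley-Reisner ring of the broken-circuit complex\<close>

text \<open>A polynomial maps exponent vectors to coefficients; multiplication on
  \<open>\<Rightarrow>\<^sub>0\<close> is convolution.\<close>

type_synonym ('e, 'k) mpoly = "('e \<Rightarrow>\<^sub>0 nat) \<Rightarrow>\<^sub>0 'k"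

definition Var :: "'e \<Rightarrow> ('e, 'k::field) mpoly" where
  "Var e = Poly_Mapping.single (Poly_Mapping.single e 1) 1"

definition Const :: "'k \<Rightarrow> ('e, 'k::field) mpoly" where
  "Const c = Poly_Mapping.single 0 c"

text \<open>The polynomial ring in the variables indexed by \<open>E\<close>, which need not be the whole
  type.\<close>

definition mpoly_ring :: "'e set \<Rightarrow> ('e, 'k::field) mpoly ring" where
  "mpoly_ring E =
     \<lparr>carrier = {p. \<forall>t\<in>Poly_Mapping.keys p. Poly_Mapping.keys t \<subseteq> E},
      monoid.mult = (*), one = 1, zero = 0, add = (+)\<rparr>"

definition total_degree :: "('e \<Rightarrow>\<^sub>0 nat) \<Rightarrow> nat" where
  "total_degree t = (\<Sum>e\<in>Poly_Mapping.keys t. Poly_Mapping.lookup t e)"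

definition homogeneous_polys :: "'e set \<Rightarrow> nat \<Rightarrow> ('e, 'k::field) mpoly set" where
  "homogeneous_polys E d =
     {p \<in> carrier (mpoly_ring E). \<forall>t\<in>Poly_Mapping.keys p. total_degree t = d}"

definition bc_ideal :: "('v, 'e) ugraph \<Rightarrow> 'e rel \<Rightarrow> ('e, 'k::field) mpoly set" where
  "bc_ideal G r =
     Idl\<^bsub>mpoly_ring (edges G)\<^esub> {\<Prod>e\<in>B. Var e | B. B \<in> broken_circuits G r}"

text \<open>The Hilbert series of the standard graded algebra \<open>mpoly_ring E Quot I\<close>, for a
  homogeneous ideal \<open>I\<close>: its component of degree \<open>d\<close> is the image of the homogeneous
  polynomials of degree \<open>d\<close>, and the ground field is embedded as the residue classes of the
  constants.\<close>

definition hilbert_series :: "'e set \<Rightarrow> ('e, 'k::field) mpoly set \<Rightarrow> rat fps" where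
  "hilbert_series E I =
     (let P = mpoly_ring E;
          residue = (\<lambda>p. I +>\<^bsub>P\<^esub> p);
          K = residue ` range Const
      in Abs_fps (\<lambda>d. of_nat (ring.dim (P Quot I) K (residue ` homogeneous_polys E d))))"

end

theory Submission
  imports Defs "HOL-Number_Theory.Cong" "HOL-Combinatorics.Transposition"
begin

text \<open>Evaluated at \<open>z = 1 / (1 - q)\<close>, the h-polynomial of the broken-circuit complex is, up to an
  explicit factor, the number of proper \<open>q\<close>-colorings of the graph (Whitney). For \<open>K\<^sub>m\<^sub>,\<^sub>n\<close> one
  counts these directly: color the first part, using exactly \<open>k\<close> colors, and then each vertex of
  the second part with one of the remaining \<open>q - k\<close> colors. Infinitely many \<open>q\<close> determine the
  polynomial. For the Hilbert series, the monomials whose support is a face form a basis of the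
  Stanley-Reisner ring, and those with support \<open>F\<close> contribute \<open>(z / (1 - z)) ^ card F\<close>.\<close>

section \<open>Colorings constant on a forest\<close>

text \<open>The substitution is dictated by the shape of h. With d = |V| - 1, w = q - 1 and z = -1/w
  one has 1 - z = q/w, so w^d z^i (1-z)^(d-i) = (-1)^i q^(d-i), and h turns into the alternating sum
  of the face numbers against powers of q. Reading this sum as a count of colorings removes the edge
  order from the problem, which is why any order gives the same answer. The factors of the claimed
  formula have the same origin: 1 + az becomes (q-1-a)/(q-1), so the product over a, together with q
  and q - 1, is the falling factorial q(q-1)...(q-k+1). Its product with the Stirling number counts
  the colorings of the first part with exactly k colors, while (1+(k-1)z)^n becomes ((q-k)/(q-1))^n
  and accounts for the second part. The asymmetry between m and n reflects which part is colored
  first.\<close>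

locale finite_loopless_graph =
  fixes G :: "('v, 'e) ugraph"
  assumes finite_verts: "finite (verts G)"
    and finite_edges: "finite (edges G)"
    and ends_edge: "e \<in> edges G \<Longrightarrow> \<exists>u\<in>verts G. \<exists>v\<in>verts G. u \<noteq> v \<and> ends G e = {u, v}"
begin

definition adj :: "'e set \<Rightarrow> 'v rel" where
  "adj F = {(x, y). \<exists>e\<in>F. ends G e = {x, y}}"

definition colorings :: "nat \<Rightarrow> ('v \<Rightarrow> nat) set" where
  "colorings q = verts G \<rightarrow>\<^sub>E {..<q}"

definition mono_edge :: "('v \<Rightarrow> nat) \<Rightarrow> 'e \<Rightarrow> bool" where
  "mono_edge c e \<longleftrightarrow> (\<forall>x\<in>ends G e. \<forall>y\<in>ends G e. c x = c y)"

definition proper :: "('v \<Rightarrow> nat) \<Rightarrow> bool" where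
  "proper c \<longleftrightarrow> (\<forall>e\<in>edges G. \<not> mono_edge c e)"

lemma mono_edge_iff: "ends G e = {x, y} \<Longrightarrow> mono_edge c e \<longleftrightarrow> c x = c y"
  by (auto simp: mono_edge_def)

lemma finite_colorings: "finite (colorings q)"
  unfolding colorings_def by (intro finite_PiE finite_verts) auto

text \<open>Loop erasure: when a step of the walk returns to a vertex already visited, the path is
  cut back to that vertex. Distinctness of the vertices is what \<open>is_cycle\<close> will ask for
  once the path is closed.\<close>

lemma path_if_reachable:
  assumes "(u, v) \<in> (adj F)\<^sup>*" "F \<subseteq> edges G" "u \<in> verts G"
  shows "\<exists>vs es. length vs = Suc (length es) \<and> distinct vs \<and> set vs \<subseteq> verts G \<and> set es \<subseteq> F \<and>
    vs ! 0 = u \<and> vs ! length es = v \<and> (\<forall>i<length es. ends G (es ! i) = {vs ! i, vs ! Suc i})"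
  using assms(1)
proof (induction rule: rtrancl_induct)
  case base
  show ?case
    by (rule exI[of _ "[u]"], rule exI[of _ "[]"]) (use assms in auto)
next
  case (step y z)
  then obtain vs es where p: "length vs = Suc (length es)" "distinct vs" "set vs \<subseteq> verts G"
    "set es \<subseteq> F" "vs ! 0 = u" "vs ! length es = y"
    "\<And>i. i < length es \<Longrightarrow> ends G (es ! i) = {vs ! i, vs ! Suc i}" by blast
  from step(2) obtain e where e: "e \<in> F" "ends G e = {y, z}" by (auto simp: adj_def)
  then have z: "z \<in> verts G" using ends_edge[of e] assms(2) by (auto simp: doubleton_eq_iff)
  show ?case
  proof (cases "z \<in> set vs")
    case True
    then obtain j where j: "j \<le> length es" "vs ! j = z"
      using p(1) by (metis in_set_conv_nth less_Suc_eq_le)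
    show ?thesis
    proof (intro exI conjI allI impI)
      show "length (take (Suc j) vs) = Suc (length (take j es))" using p(1) j by simp
      show "set (take (Suc j) vs) \<subseteq> verts G" "set (take j es) \<subseteq> F"
        using p(3,4) set_take_subset by fast+
    qed (use p j in auto)
  next
    case False
    show ?thesis
      by (rule exI[of _ "vs @ [z]"], rule exI[of _ "es @ [e]"])
        (use p e z False in \<open>auto simp: nth_append less_Suc_eq\<close>)
  qed
qed

text \<open>A path between the ends of \<open>e\<close> that avoids \<open>e\<close> is closed by
  appending \<open>e\<close>, whose successor index wraps around to 0. Distinct vertices force
  distinct edges: if edges i < j coincided, vertex i would be vertex j or j + 1. The path has at
  least one edge because \<open>e\<close> is not a loop, so the cycle has length at least 2.\<close>

lemma cycle_if_reachable:
  assumes "(u, v) \<in> (adj (F - {e}))\<^sup>*" "F \<subseteq> edges G" "e \<in> F" "ends G e = {u, v}"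
  shows "\<exists>C. is_cycle G C \<and> C \<subseteq> F"
proof -
  have uv: "u \<noteq> v" "u \<in> verts G"
    using ends_edge[of e] assms by (auto simp: doubleton_eq_iff)
  obtain vs es where p: "length vs = Suc (length es)" "distinct vs" "set vs \<subseteq> verts G"
    "set es \<subseteq> F - {e}" "vs ! 0 = u" "vs ! length es = v"
    "\<And>i. i < length es \<Longrightarrow> ends G (es ! i) = {vs ! i, vs ! Suc i}"
    using path_if_reachable[OF assms(1) _ uv(2)] assms(2) by blast
  have neq: "es ! i \<noteq> es ! j" if "i < j" "j < length es" for i j
  proof
    assume "es ! i = es ! j"
    then have "vs ! i \<in> {vs ! j, vs ! Suc j}" using p(7)[of i] p(7)[of j] that by auto
    then show False using p(1,2) that by (auto simp: nth_eq_iff_index_eq)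
  qed
  have mod: "Suc i mod Suc (length es) = Suc i" if "i < length es" for i
    using that by simp
  have "distinct es"
    unfolding distinct_conv_nth by (metis neq linorder_neqE_nat)
  moreover have "es \<noteq> []" using p uv by auto
  ultimately have "is_cycle G (set (es @ [e]))"
    unfolding is_cycle_def
    by (intro exI[of _ vs] exI[of _ "es @ [e]"])
      (use p assms in \<open>auto simp: nth_append less_Suc_eq Suc_le_eq mod\<close>)
  moreover have "set (es @ [e]) \<subseteq> F" using p(4) assms(3) by auto
  ultimately show ?thesis by blast
qed

text \<open>Recoloring the connected component of one end of an edge \<open>e\<close> of a forest \<open>F\<close> makes all pairs
  of colors on the two ends equally frequent among the colorings that are constant on the edges
  of \<open>F - {e}\<close>.\<close>

lemma card_mono_colorings_remove:
  assumes F: "F \<subseteq> edges G" "e \<in> F" and acyc: "\<And>C. is_cycle G C \<Longrightarrow> \<not> C \<subseteq> F"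
  shows "q * card {c \<in> colorings q. \<forall>f\<in>F. mono_edge c f} =
    card {c \<in> colorings q. \<forall>f\<in>F - {e}. mono_edge c f}" (is "_ = card ?A")
proof -
  obtain u v where uv: "u \<in> verts G" "v \<in> verts G" "u \<noteq> v" "ends G e = {u, v}"
    using ends_edge F by blast
  \<comment> \<open>The component of \<open>v\<close> in the forest without \<open>e\<close>. It
    misses \<open>u\<close>, since a path from \<open>u\<close> to \<open>v\<close> closed by
    \<open>e\<close> would be a cycle inside \<open>F\<close>.\<close>
  define R where "R = {x \<in> verts G. (x, v) \<in> (adj (F - {e}))\<^sup>*}"
  have uR: "u \<notin> R" "v \<in> R"
    using cycle_if_reachable[OF _ F uv(4)] acyc uv unfolding R_def by blast+
  define A where "A a b = {c \<in> ?A. c u = a \<and> c v = b}" for a b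
  \<comment> \<open>Swaps two colors on \<open>R\<close> only. No edge of \<open>F - {e}\<close>
    joins \<open>R\<close> to its complement, so constancy on these edges survives; the color of
    \<open>u\<close> is untouched while that of \<open>v\<close> moves from \<open>b\<close> to
    \<open>b'\<close>.\<close>
  define T where "T b b' c = (\<lambda>x. if x \<in> R then Transposition.transpose b b' (c x) else c x)" for b b' :: nat and c :: "'v \<Rightarrow> nat"
  have T_commute: "T b b' = T b' b" for b b'
    by (simp add: T_def fun_eq_iff transpose_commute)
  have TT: "T b b' (T b b' c) = c" for b b' c by (auto simp: T_def)
  have TA: "T b b' c \<in> A a b'" if c: "c \<in> A a b" and lt: "b < q" "b' < q" for a b b' c
  proof -
    have col: "T b b' c \<in> colorings q"
      using c lt by (auto simp: A_def colorings_def T_def PiE_iff extensional_def R_def Transposition.transpose_def)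
    have mono: "mono_edge (T b b' c) f" if f: "f \<in> F - {e}" for f
    proof -
      obtain x y where xy: "x \<in> verts G" "y \<in> verts G" "ends G f = {x, y}"
        using ends_edge[of f] f F by blast
      then have "(x, y) \<in> adj (F - {e})" "(y, x) \<in> adj (F - {e})" using f by (auto simp: adj_def)
      then have "x \<in> R \<longleftrightarrow> y \<in> R" using xy by (auto simp: R_def intro: converse_rtrancl_into_rtrancl)
      moreover have "c x = c y" using c f xy by (auto simp: A_def mono_edge_def)
      ultimately show ?thesis using xy by (auto simp: mono_edge_def T_def)
    qed
    show ?thesis using col mono uR c by (auto simp: A_def T_def)
  qed
  have card_A: "card (A a b) = card (A a a)" if "a < q" "b < q" for a b
  proof -
    have "bij_betw (T b a) (A a b) (A a a)"
    proof (rule bij_betw_byWitness[where f' = "T b a"])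
      show "T b a ` A a b \<subseteq> A a a" using TA that by blast
      show "T b a ` A a a \<subseteq> A a b" using TA[of _ a a b] that
        by (auto simp: T_commute[of b a])
    qed (auto simp: TT)
    then show ?thesis by (rule bij_betw_same_card)
  qed
  have finA: "finite (A a b)" for a b
    using finite_colorings[of q] by (auto simp: A_def)
  \<comment> \<open>The colorings are sorted by the colors a of \<open>u\<close> and b of
    \<open>v\<close>. Each class is as large as the diagonal class \<open>A a a\<close>, and the
    diagonal classes together are the colorings constant on all of \<open>F\<close>.\<close>
  have "?A = (\<Union>a<q. \<Union>b<q. A a b)"
    using uv by (auto simp: A_def colorings_def PiE_iff)
  also have "card \<dots> = (\<Sum>a<q. card (\<Union>b<q. A a b))"
    using finA by (subst card_UN_disjoint) (auto simp: A_def)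
  also have "\<dots> = (\<Sum>a<q. \<Sum>b<q. card (A a b))"
    using finA by (intro sum.cong refl, subst card_UN_disjoint) (auto simp: A_def)
  also have "\<dots> = (\<Sum>a<q. q * card (A a a))"
  proof (intro sum.cong refl)
    fix a assume "a \<in> {..<q}"
    then have "(\<Sum>b<q. card (A a b)) = (\<Sum>b<q. card (A a a))"
      by (intro sum.cong refl card_A) auto
    then show "(\<Sum>b<q. card (A a b)) = q * card (A a a)" by simp
  qed
  also have "\<dots> = q * card (\<Union>a<q. A a a)"
    unfolding sum_distrib_left[symmetric]
    by (subst card_UN_disjoint) (use finA in \<open>auto simp: A_def\<close>)
  also have "(\<Union>a<q. A a a) = {c \<in> colorings q. \<forall>f\<in>F. mono_edge c f}"
  proof -
    have "(\<forall>f\<in>F. mono_edge c f) \<longleftrightarrow> c u = c v \<and> (\<forall>f\<in>F - {e}. mono_edge c f)" for c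
      using mono_edge_iff[OF uv(4), of c] F(2) by blast
    then show ?thesis using uv by (auto simp: A_def colorings_def PiE_iff)
  qed
  finally show ?thesis by simp
qed

text \<open>The product form avoids a truncated exponent |V| - |F|: that |F| is at most |V| is
  itself deduced from this lemma, in \<open>card_forest_less\<close>.\<close>

lemma card_mono_colorings:
  assumes "F \<subseteq> edges G" and "\<And>C. is_cycle G C \<Longrightarrow> \<not> C \<subseteq> F"
  shows "q ^ card F * card {c \<in> colorings q. \<forall>f\<in>F. mono_edge c f} = q ^ card (verts G)"
proof -
  have "finite F" using assms(1) finite_edges finite_subset by blast
  then show ?thesis using assms
  proof (induction F)
    case empty
    then show ?case using finite_verts by (simp add: colorings_def card_PiE)
  next
    case (insert e F)
    have rem: "q * card {c \<in> colorings q. \<forall>f\<in>insert e F. mono_edge c f} =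
      card {c \<in> colorings q. \<forall>f\<in>F. mono_edge c f}"
      using card_mono_colorings_remove[OF insert.prems(1) _ insert.prems(2), of e q] insert.hyps
      by (simp add: Diff_insert_absorb del: insert_iff Diff_insert0) simp
    have "\<not> C \<subseteq> F" if "is_cycle G C" for C
      using insert.prems(2)[OF that] by blast
    then have "q ^ card F * card {c \<in> colorings q. \<forall>f\<in>F. mono_edge c f} = q ^ card (verts G)"
      using insert.IH insert.prems(1) by blast
    then show ?case
      unfolding rem[symmetric] card_insert_disjoint[OF insert.hyps] power_Suc by (simp only: mult_ac)
  qed
qed

text \<open>With two colors, the two constant colorings are constant on every edge, so the forest
  count is at least 2 and 2^(|F|+1) is at most 2^|V|.\<close>

lemma card_forest_less:
  assumes "F \<subseteq> edges G" "\<And>C. is_cycle G C \<Longrightarrow> \<not> C \<subseteq> F" "verts G \<noteq> {}"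
  shows "card F < card (verts G)"
proof -
  let ?M = "{c \<in> colorings 2. \<forall>f\<in>F. mono_edge c f}"
  have "mono_edge (restrict (\<lambda>_. a) (verts G)) f" if f: "f \<in> F" for a f
  proof -
    obtain x y where "x \<in> verts G" "y \<in> verts G" "ends G f = {x, y}"
      using ends_edge[of f] f assms(1) by blast
    then show ?thesis by (auto simp: mono_edge_def)
  qed
  then have "(\<lambda>a. restrict (\<lambda>_. a) (verts G)) ` {..<2} \<subseteq> ?M"
    by (auto simp: colorings_def)
  moreover have "inj_on (\<lambda>a. restrict (\<lambda>_. a) (verts G)) {..<2::nat}"
    using assms(3) by (auto simp: inj_on_def restrict_def fun_eq_iff)
  ultimately have "card {..<2::nat} \<le> card ?M"
    using finite_colorings[of 2] by (intro card_inj_on_le) auto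
  then have "2 \<le> card ?M" by simp
  then have "2 ^ card F * 2 \<le> 2 ^ card F * card ?M" by simp
  also have "\<dots> = 2 ^ card (verts G)" using card_mono_colorings[OF assms(1,2), of 2] by simp
  finally have "(2::nat) ^ Suc (card F) \<le> 2 ^ card (verts G)" by simp
  then have "Suc (card F) \<le> card (verts G)" by (subst (asm) power_increasing_iff) auto
  then show ?thesis by simp
qed

text \<open>The other edges of the cycle form a path between the ends of \<open>e\<close>, along
  which the color cannot change.\<close>

lemma cycle_closing_edge_mono:
  assumes "is_cycle G C" "e \<in> C" "\<And>f. f \<in> C - {e} \<Longrightarrow> mono_edge c f"
  shows "mono_edge c e"
proof -
  obtain vs es where p: "length vs = length es" "2 \<le> length es" "distinct es"
    "\<And>i. i < length es \<Longrightarrow> ends G (es ! i) = {vs ! i, vs ! (Suc i mod length es)}" "C = set es"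
    using assms(1) unfolding is_cycle_def by blast
  define l where "l = length es"
  obtain k where k: "k < l" "es ! k = e" using assms(2) p(5) by (metis in_set_conv_nth l_def)
  \<comment> \<open>The edge \<open>e\<close> at position k joins the vertices k and k + 1 modulo l.
    The walk starts at vertex k + 1 and reaches vertex k after l - 1 steps; it would use
    \<open>e\<close> itself only if l divided some positive number below l.\<close>
  have step: "c (vs ! ((Suc k + j) mod l)) = c (vs ! (Suc k mod l))" if "j < l" for j
    using that
  proof (induction j)
    case (Suc j)
    define i where "i = (Suc k + j) mod l"
    have "i \<noteq> k"
    proof
      assume "i = k"
      then have "[k + Suc j = k + 0] (mod l)" using k by (simp add: i_def cong_def)
      then have "[Suc j = 0] (mod l)" by (subst (asm) cong_add_lcancel_nat)
      then show False using Suc.prems by (simp add: cong_def)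
    qed
    moreover have "i < l" using k by (simp add: i_def)
    ultimately have "es ! i \<in> C - {e}"
      using p k by (auto simp: l_def nth_eq_iff_index_eq)
    then have "mono_edge c (es ! i)" by (rule assms(3))
    then have "c (vs ! i) = c (vs ! (Suc i mod l))"
      using p(4)[of i] \<open>i < l\<close> mono_edge_iff unfolding l_def by blast
    then show ?case using Suc by (simp add: i_def mod_Suc_eq)
  qed simp
  have "(Suc k + (l - 1)) mod l = k" using k by simp
  then have "c (vs ! k) = c (vs ! (Suc k mod l))"
    using step[of "l - 1"] k by simp
  then show ?thesis using p(4)[of k] k mono_edge_iff unfolding l_def by blast
qed

end

section \<open>Broken circuits and the chromatic polynomial\<close>

lemma linear_order_on_max_exists:
  assumes "linear_order_on A r" "finite S" "S \<noteq> {}" "S \<subseteq> A"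
  shows "\<exists>e\<in>S. \<forall>f\<in>S. (f, e) \<in> r"
  using assms(2-4)
proof (induction rule: finite_ne_induct)
  case (singleton x)
  then show ?case
    using assms(1) by (auto simp: linear_order_on_def partial_order_on_def preorder_on_def refl_on_def)
next
  case (insert x S)
  then obtain e where e: "e \<in> S" "\<And>f. f \<in> S \<Longrightarrow> (f, e) \<in> r" by auto
  have tr: "trans r" and tot: "total_on A r" and rf: "refl_on A r"
    using assms(1) by (auto simp: linear_order_on_def partial_order_on_def preorder_on_def)
  have xe: "(x, e) \<in> r \<or> (e, x) \<in> r" and xx: "(x, x) \<in> r"
    using tot rf insert.prems e(1) insert.hyps by (auto simp: total_on_def refl_on_def)
  show ?case
  proof (cases "(x, e) \<in> r")
    case True
    then show ?thesis using e by blast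
  next
    case False
    then have "(e, x) \<in> r" using xe by blast
    then have "(f, x) \<in> r" if "f \<in> insert x S" for f
      using that e(2) xx tr by (auto dest: transD)
    then show ?thesis by blast
  qed
qed

context finite_loopless_graph
begin

lemma finite_bc_complex: "finite (bc_complex G r)"
  using finite_edges by (auto simp: bc_complex_def intro: finite_subset[of _ "Pow (edges G)"])

lemma cycle_finite: "is_cycle G C \<Longrightarrow> finite C \<and> C \<subseteq> edges G \<and> 2 \<le> card C"
  unfolding is_cycle_def by (auto simp: distinct_card)

text \<open>A cycle has at least two edges, so no broken circuit is empty. This supplies the only
  face that survives for a proper coloring, and it also keeps 1 out of the Stanley-Reisner
  ideal.\<close>

lemma empty_in_bc_complex: "{} \<in> bc_complex G r"
proof -
  have "C - {e} \<noteq> {}" if "is_cycle G C" for C e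
  proof
    assume "C - {e} = {}"
    then have "card C \<le> card {e}" by (intro card_mono) auto
    then show False using cycle_finite[OF that] by simp
  qed
  then show ?thesis by (auto simp: bc_complex_def broken_circuits_def)
qed

text \<open>A cycle inside \<open>F\<close> would bring its own broken circuit along. Hence faces
  are forests, and the forest count applies to them.\<close>

lemma bc_complex_acyclic:
  assumes "linear_order_on (edges G) r" "F \<in> bc_complex G r" "is_cycle G C"
  shows "\<not> C \<subseteq> F"
proof
  assume CF: "C \<subseteq> F"
  have "finite C" "C \<subseteq> edges G" "C \<noteq> {}" using cycle_finite[OF assms(3)] by auto
  then obtain e where "e \<in> C" "\<forall>f\<in>C. (f, e) \<in> r"
    using linear_order_on_max_exists[OF assms(1)] by blast
  then have "C - {e} \<in> broken_circuits G r" using assms(3) by (auto simp: broken_circuits_def)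
  then show False using assms(2) CF by (auto simp: bc_complex_def)
qed

text \<open>Since the set \<open>M\<close> of edges constant under \<open>c\<close> contains the maximum of every
  cycle whose other edges it contains, toggling the maximum of \<open>M\<close> is a sign-reversing involution on
  the faces inside \<open>M\<close>.\<close>

lemma bc_complex_alternating_sum:
  assumes lin: "linear_order_on (edges G) r"
  shows "(\<Sum>F\<in>{F \<in> bc_complex G r. \<forall>f\<in>F. mono_edge c f}. (-1) ^ card F) = (of_bool (proper c) :: int)"
proof (cases "proper c")
  case True
  then have "F = {}" if "F \<in> bc_complex G r" "\<forall>f\<in>F. mono_edge c f" for F
    using that unfolding proper_def bc_complex_def by blast
  then have "{F \<in> bc_complex G r. \<forall>f\<in>F. mono_edge c f} = {{}}"
    using empty_in_bc_complex by blast
  then show ?thesis using True by simp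
next
  case False
  define M where "M = {e \<in> edges G. mono_edge c e}"
  have "M \<noteq> {}" "finite M" "M \<subseteq> edges G" using False finite_edges by (auto simp: M_def proper_def)
  from linear_order_on_max_exists[OF lin this(2,1,3)]
  obtain e where e: "e \<in> M" "\<And>f. f \<in> M \<Longrightarrow> (f, e) \<in> r" by blast
  define S where "S = {F \<in> bc_complex G r. \<forall>f\<in>F. mono_edge c f}"
  define S0 where "S0 = {F \<in> S. e \<notin> F}"
  have SM: "F \<subseteq> M" if "F \<in> S" for F using that by (auto simp: S_def M_def bc_complex_def)
  have ins: "insert e F \<in> S" if "F \<in> S0" for F
  proof -
    have F: "F \<in> bc_complex G r" "F \<subseteq> M" "\<forall>f\<in>F. mono_edge c f"
      using that SM by (auto simp: S0_def S_def)
    have "\<not> C - {g} \<subseteq> insert e F"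
      if C: "is_cycle G C" "g \<in> C" "\<forall>f\<in>C. (f, g) \<in> r" for C g
    proof
      assume sub: "C - {g} \<subseteq> insert e F"
      moreover have "\<not> C - {g} \<subseteq> F"
        using F(1) C unfolding bc_complex_def broken_circuits_def by blast
      ultimately have eC: "e \<in> C - {g}" by blast
      \<comment> \<open>A broken circuit created by adding \<open>e\<close> would have a cycle
        maximum \<open>g\<close> that lies in \<open>M\<close> as well. Then \<open>g\<close> is at
        most \<open>e\<close> as \<open>e\<close> is the maximum of \<open>M\<close>, and
        \<open>e\<close> is at most \<open>g\<close> as \<open>e\<close> lies on the cycle, so
        \<open>g = e\<close>, although \<open>e\<close> belongs to \<open>C - {g}\<close>.\<close>
      have "mono_edge c g"
        by (rule cycle_closing_edge_mono[OF C(1,2)]) (use sub F e M_def in blast)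
      then have "g \<in> M" using cycle_finite[OF C(1)] C(2) by (auto simp: M_def)
      then have "(g, e) \<in> r" "(e, g) \<in> r" using e(2) C(3) eC by auto
      then have "g = e"
        using lin by (auto simp: linear_order_on_def partial_order_on_def antisym_def)
      then show False using eC by blast
    qed
    then show ?thesis
      using F e(1) by (auto simp: S_def M_def bc_complex_def broken_circuits_def)
  qed
  have del: "F - {e} \<in> S0" if "F \<in> S" for F
    using that unfolding S0_def S_def bc_complex_def by blast
  have finS: "finite S" "finite S0" using finite_bc_complex by (auto simp: S_def S0_def)
  have "S = S0 \<union> insert e ` S0"
  proof (intro equalityI subsetI)
    fix F assume "F \<in> S"
    then show "F \<in> S0 \<union> insert e ` S0"
      using del[of F] by (cases "e \<in> F") (auto simp: S0_def image_iff insert_absorb intro!: bexI[of _ "F - {e}"])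
  qed (use ins S0_def in auto)
  moreover have "S0 \<inter> insert e ` S0 = {}" by (auto simp: S0_def)
  ultimately have "(\<Sum>F\<in>S. (-1) ^ card F :: int) = (\<Sum>F\<in>S0. (-1) ^ card F) + (\<Sum>F\<in>insert e ` S0. (-1) ^ card F)"
    using finS sum.union_disjoint[of S0 "insert e ` S0" "\<lambda>F. (-1) ^ card F"] by simp
  also have "(\<Sum>F\<in>insert e ` S0. (-1) ^ card F :: int) = (\<Sum>F\<in>S0. (-1) ^ card (insert e F))"
    by (subst sum.reindex) (auto simp: inj_on_def S0_def)
  also have "\<dots> = - (\<Sum>F\<in>S0. (-1) ^ card F)"
    unfolding sum_negf[symmetric]
  proof (intro sum.cong refl)
    fix F assume "F \<in> S0"
    then have "finite F" "e \<notin> F"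
      using finite_edges finite_subset by (auto simp: S0_def S_def bc_complex_def)
    then show "(-1 :: int) ^ card (insert e F) = - ((-1) ^ card F)" by simp
  qed
  finally show ?thesis using False by (simp add: S_def)
qed

lemma card_bc_face_less:
  assumes "linear_order_on (edges G) r" "verts G \<noteq> {}" "F \<in> bc_complex G r"
  shows "card F < card (verts G)"
  using card_forest_less[OF _ bc_complex_acyclic[OF assms(1,3)] assms(2)] assms(3)
  by (auto simp: bc_complex_def)

text \<open>Double counting, with sign \<open>(-1) ^ card F\<close>, of the pairs of a coloring and
  a face on whose edges it is constant. For a fixed coloring the signs sum to 1 or 0 according to
  properness; for a fixed face the forest count applies, and \<open>q > 0\<close> permits cancelling
  q^|F|.\<close>

theorem chromatic_broken_circuit:
  assumes lin: "linear_order_on (edges G) r" and "verts G \<noteq> {}" "q > 0"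
  shows "int (card {c \<in> colorings q. proper c}) =
    (\<Sum>F\<in>bc_complex G r. (-1) ^ card F * int q ^ (card (verts G) - card F))"
proof -
  have "int (card {c \<in> colorings q. proper c}) = (\<Sum>c\<in>colorings q. of_bool (proper c))"
    using finite_colorings by (simp add: Int_def)
  also have "\<dots> = (\<Sum>c\<in>colorings q. \<Sum>F\<in>{F \<in> bc_complex G r. \<forall>f\<in>F. mono_edge c f}. (-1) ^ card F)"
    by (simp only: bc_complex_alternating_sum[OF lin])
  also have "\<dots> = (\<Sum>F\<in>bc_complex G r. \<Sum>c\<in>{c \<in> colorings q. \<forall>f\<in>F. mono_edge c f}. (-1) ^ card F)"
    by (rule sum.swap_restrict) (auto simp: finite_colorings finite_bc_complex)
  also have "\<dots> = (\<Sum>F\<in>bc_complex G r. (-1) ^ card F * int q ^ (card (verts G) - card F))"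
  proof (intro sum.cong refl)
    fix F assume F: "F \<in> bc_complex G r"
    let ?M = "{c \<in> colorings q. \<forall>f\<in>F. mono_edge c f}"
    have "card F \<le> card (verts G)" using card_bc_face_less[OF lin assms(2) F] by simp
    then have "q ^ card F * card ?M = q ^ card F * q ^ (card (verts G) - card F)"
      using card_mono_colorings[OF _ bc_complex_acyclic[OF lin F], of q] F
      by (simp add: bc_complex_def flip: power_add)
    then have "card ?M = q ^ (card (verts G) - card F)" using assms(3) by simp
    then show "(\<Sum>c\<in>?M. (-1) ^ card F) = (-1) ^ card F * int q ^ (card (verts G) - card F)"
      by simp
  qed
  finally show ?thesis .
qed

end

section \<open>Integer polynomials over larger coefficient rings, since the evaluation points are
  fractions\<close>

lemma map_poly_of_int_add: "map_poly of_int (p + q) = map_poly of_int p + (map_poly of_int q :: 'a::comm_ring_1 poly)"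
  by (intro poly_eqI) (simp add: coeff_map_poly)

lemma map_poly_of_int_mult: "map_poly of_int (p * q) = map_poly of_int p * (map_poly of_int q :: 'a::comm_ring_1 poly)"
  by (intro poly_eqI) (simp add: coeff_map_poly coeff_mult)

lemma map_poly_of_int_power: "map_poly of_int (p ^ k) = (map_poly of_int p :: 'a::comm_ring_1 poly) ^ k"
  by (induction k) (simp_all add: map_poly_of_int_mult)

lemma map_poly_of_int_sum: "map_poly of_int (\<Sum>x\<in>A. f x) = (\<Sum>x\<in>A. map_poly of_int (f x) :: 'a::comm_ring_1 poly)"
  by (induction A rule: infinite_finite_induct) (simp_all add: map_poly_of_int_add)

lemma map_poly_of_int_prod: "map_poly of_int (\<Prod>x\<in>A. f x) = (\<Prod>x\<in>A. map_poly of_int (f x) :: 'a::comm_ring_1 poly)"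
  by (induction A rule: infinite_finite_induct) (simp_all add: map_poly_of_int_mult)

lemma map_poly_of_int_of_int: "map_poly of_int (of_int k) = (of_int k :: 'a::comm_ring_1 poly)"
  by (simp add: of_int_poly map_poly_pCons)

lemmas map_poly_of_int_hom = map_poly_of_int_add map_poly_of_int_mult map_poly_of_int_power
  map_poly_of_int_sum map_poly_of_int_prod

text \<open>Replaces a sum weighted by face numbers with a sum over the faces themselves, so that h
  can be compared with Whitney's sum face by face.\<close>

lemma sum_card_fibre:
  fixes g :: "nat \<Rightarrow> 'a::comm_semiring_1"
  assumes "finite S" "\<And>F. F \<in> S \<Longrightarrow> card F \<le> d"
  shows "(\<Sum>i\<le>d. of_nat (card {F \<in> S. card F = i}) * g i) = (\<Sum>F\<in>S. g (card F))"
proof -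
  have "(\<Sum>F\<in>S. g (card F)) = (\<Sum>i\<le>d. \<Sum>F\<in>{F \<in> S. card F = i}. g (card F))"
    using assms by (subst sum.group) auto
  also have "\<dots> = (\<Sum>i\<le>d. of_nat (card {F \<in> S. card F = i}) * g i)"
    by (intro sum.cong refl) simp
  finally show ?thesis by simp
qed

lemma (in finite_loopless_graph) h_poly_eq_sum_faces:
  assumes "linear_order_on (edges G) r" "verts G \<noteq> {}"
  shows "h_poly G r = (\<Sum>F\<in>bc_complex G r. monom 1 (card F) * [:1, - 1:] ^ (card (verts G) - 1 - card F))"
proof -
  have "card F \<le> card (verts G) - 1" if "F \<in> bc_complex G r" for F
    using card_bc_face_less[OF assms that] by simp
  from sum_card_fibre[OF finite_bc_complex this, of r]
  show ?thesis by (simp add: h_poly_def mult.assoc)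
qed

text \<open>The factor q raises the exponent d - i of q to |V| - i, as in the chromatic sum;
  \<open>q \<ge> 2\<close> makes the evaluation point finite.\<close>

lemma (in finite_loopless_graph) h_poly_chromatic:
  assumes lin: "linear_order_on (edges G) r" and "verts G \<noteq> {}" and "q \<ge> 2"
  shows "of_nat q * (of_nat q - 1) ^ (card (verts G) - 1) *
      poly (map_poly rat_of_int (h_poly G r)) (- 1 / (of_nat q - 1)) =
    of_nat (card {c \<in> colorings q. proper c})"
proof -
  define w where "w = rat_of_nat q - 1"
  define d where "d = card (verts G) - 1"
  have w: "w \<noteq> 0" and wq: "1 - - 1 / w = of_nat q / w" using assms(3) by (auto simp: w_def field_simps)
  have eval_term: "of_nat q * w ^ d * poly (map_poly rat_of_int (monom 1 i * [:1, - 1:] ^ (d - i))) (- 1 / w) =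
    (-1) ^ i * of_nat q ^ (Suc d - i)" if "i \<le> d" for i
  proof -
    have "poly (map_poly rat_of_int (monom 1 i * [:1, - 1:] ^ (d - i))) (- 1 / w) =
      (- 1 / w) ^ i * (of_nat q / w) ^ (d - i)"
      unfolding wq[symmetric] by (simp add: map_poly_of_int_hom map_poly_monom map_poly_pCons poly_monom)
    moreover have "w ^ d = w ^ i * w ^ (d - i)" using that by (simp flip: power_add)
    moreover have "Suc d - i = Suc (d - i)" using that by simp
    ultimately show ?thesis using w power_divide[of "-1" w i] by (simp add: power_divide)
  qed
  have le: "card F \<le> d" if "F \<in> bc_complex G r" for F
    using card_bc_face_less[OF assms(1,2) that] by (simp add: d_def)
  have d: "Suc d = card (verts G)" using assms(2) finite_verts by (simp add: d_def card_gt_0_iff)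
  have "of_nat q * w ^ d * poly (map_poly rat_of_int (h_poly G r)) (- 1 / w) =
    (\<Sum>F\<in>bc_complex G r. of_nat q * w ^ d *
      poly (map_poly rat_of_int (monom 1 (card F) * [:1, - 1:] ^ (d - card F))) (- 1 / w))"
    by (simp add: h_poly_eq_sum_faces[OF assms(1,2)] map_poly_of_int_sum poly_sum sum_distrib_left d_def)
  also have "\<dots> = (\<Sum>F\<in>bc_complex G r. (-1) ^ card F * of_nat q ^ (card (verts G) - card F))"
    unfolding d[symmetric] by (intro sum.cong refl eval_term le)
  also have "\<dots> = rat_of_int (int (card {c \<in> colorings q. proper c}))"
    using assms by (subst chromatic_broken_circuit[OF assms(1,2)]) simp_all
  finally show ?thesis by (simp add: w_def d_def)
qed

section \<open>Complete bipartite graphs\<close>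

text \<open>The weight \<phi> is arbitrary so that the induction can change it. A function with k
  values is extended by repeating one of them or by taking one of q - k new ones, which replaces
  \<phi> k by k \<phi> k + (q-k) \<phi> (k+1); collecting coefficients yields the Stirling
  recurrence. For k > q the product contains the factor q - q = 0, matching the absence of such
  images.\<close>

lemma sum_functions_card_image:
  fixes \<phi> :: "nat \<Rightarrow> int"
  shows "(\<Sum>f\<in>{..<m} \<rightarrow>\<^sub>E {..<q}. \<phi> (card (f ` {..<m}))) =
    (\<Sum>k\<le>m. of_nat (Stirling m k) * (\<Prod>j<k. int q - int j) * \<phi> k)"
proof (induction m arbitrary: \<phi>)
  case 0
  then show ?case by simp
next
  case (Suc m)
  define P where "P k = (\<Prod>j<k. int q - int j)" for k
  have P_Suc: "P (Suc k) = P k * (int q - int k)" for k by (simp add: P_def)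
  have inner: "(\<Sum>b<q. \<phi> (card (insert b I))) =
    int (card I) * \<phi> (card I) + (int q - int (card I)) * \<phi> (Suc (card I))" if I: "I \<subseteq> {..<q}" for I
  proof -
    have fin: "finite I" using I finite_subset by blast
    have "card I \<le> q" using card_mono[OF _ I] by simp
    have "(\<Sum>b<q. \<phi> (card (insert b I))) =
      (\<Sum>b\<in>I. \<phi> (card (insert b I))) + (\<Sum>b\<in>{..<q} - I. \<phi> (card (insert b I)))"
      using sum.subset_diff[OF I, of "\<lambda>b. \<phi> (card (insert b I))"] by simp
    also have "(\<Sum>b\<in>I. \<phi> (card (insert b I))) = int (card I) * \<phi> (card I)"
      by (simp add: insert_absorb)
    also have "(\<Sum>b\<in>{..<q} - I. \<phi> (card (insert b I))) = (int q - int (card I)) * \<phi> (Suc (card I))"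
      using fin I \<open>card I \<le> q\<close> by (simp add: card_Diff_subset of_nat_diff)
    finally show ?thesis .
  qed
  have "(\<Sum>f\<in>{..<Suc m} \<rightarrow>\<^sub>E {..<q}. \<phi> (card (f ` {..<Suc m}))) =
    (\<Sum>(b, f)\<in>{..<q} \<times> ({..<m} \<rightarrow>\<^sub>E {..<q}). \<phi> (card (insert b (f ` {..<m}))))"
  proof -
    have lessThan_notin: "m \<notin> {..<m}" by simp
    have img: "(f(m := b)) ` insert m {..<m} = insert b (f ` {..<m})" for f :: "nat \<Rightarrow> nat" and b
      by auto
    show ?thesis
      unfolding lessThan_Suc PiE_insert_eq sum.reindex[OF inj_combinator[of m "{..<m}" "\<lambda>_. {..<q}", OF lessThan_notin]]
      by (intro sum.cong refl) (simp only: o_def split_beta img)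
  qed
  also have "\<dots> = (\<Sum>f\<in>{..<m} \<rightarrow>\<^sub>E {..<q}. \<Sum>b<q. \<phi> (card (insert b (f ` {..<m}))))"
    unfolding sum.cartesian_product[symmetric] by (rule sum.swap)
  also have "\<dots> = (\<Sum>f\<in>{..<m} \<rightarrow>\<^sub>E {..<q}. int (card (f ` {..<m})) * \<phi> (card (f ` {..<m}))
     + (int q - int (card (f ` {..<m}))) * \<phi> (Suc (card (f ` {..<m}))))"
    by (intro sum.cong refl inner) auto
  also have "\<dots> = (\<Sum>k\<le>m. of_nat (Stirling m k) * P k * (int k * \<phi> k + (int q - int k) * \<phi> (Suc k)))"
    unfolding P_def by (rule Suc.IH)
  also have "\<dots> = (\<Sum>k\<le>m. of_nat (Stirling m k) * P k * int k * \<phi> k) +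
      (\<Sum>k\<le>m. of_nat (Stirling m k) * P (Suc k) * \<phi> (Suc k))"
    unfolding sum.distrib[symmetric] by (intro sum.cong refl) (simp add: P_Suc algebra_simps)
  \<comment> \<open>Aligns the indices of the two sums: the new term k = m + 1 has Stirling number
    0, and the term k = 0 split off by the shift has the factor k.\<close>
  also have "(\<Sum>k\<le>m. of_nat (Stirling m k) * P k * int k * \<phi> k) =
     (\<Sum>k\<le>Suc m. of_nat (Stirling m k) * P k * int k * \<phi> k)" by simp
  also have "\<dots> = (\<Sum>k\<le>m. of_nat (Stirling m (Suc k)) * P (Suc k) * int (Suc k) * \<phi> (Suc k))"
    by (subst sum.atMost_Suc_shift) simp
  also have "\<dots> + (\<Sum>k\<le>m. of_nat (Stirling m k) * P (Suc k) * \<phi> (Suc k)) =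
    (\<Sum>k\<le>m. of_nat (Stirling (Suc m) (Suc k)) * P (Suc k) * \<phi> (Suc k))"
    unfolding sum.distrib[symmetric] by (intro sum.cong refl) (simp add: algebra_simps)
  also have "\<dots> = (\<Sum>k\<le>Suc m. of_nat (Stirling (Suc m) k) * P k * \<phi> k)"
    by (subst sum.atMost_Suc_shift) simp
  finally show ?case by (simp only: P_def)
qed

lemma finite_loopless_complete_bipartite: "finite_loopless_graph (complete_bipartite m n)"
  by unfold_locales (auto simp: complete_bipartite_def)

lemma card_verts_complete_bipartite: "card (verts (complete_bipartite m n)) = m + n"
  by (simp add: complete_bipartite_def card_Plus flip: Plus_def)

text \<open>The number of admissible colorings of the second part depends on the coloring of the
  first only through the size of its image, which is the kind of weight that
  \<open>sum_functions_card_image\<close> sums.\<close>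

lemma chromatic_complete_bipartite:
  fixes m n q :: nat
  defines "G \<equiv> complete_bipartite m n"
  shows "int (card {c \<in> finite_loopless_graph.colorings G q. finite_loopless_graph.proper G c}) =
    (\<Sum>k\<le>m. of_nat (Stirling m k) * (\<Prod>j<k. int q - int j) * (int q - int k) ^ n)"
proof -
  interpret finite_loopless_graph G unfolding G_def by (rule finite_loopless_complete_bipartite)
  let ?A = "{..<m} \<rightarrow>\<^sub>E {..<q}"
  let ?B = "\<lambda>f. {..<n} \<rightarrow>\<^sub>E ({..<q} - f ` {..<m})"
  have proper_iff: "proper c \<longleftrightarrow> (\<forall>i<m. \<forall>j<n. c (Inl i) \<noteq> c (Inr j))" for c
    unfolding proper_def mono_edge_def by (auto simp: G_def complete_bipartite_def)
  have colorings_eq: "colorings q = Inl ` {..<m} \<union> Inr ` {..<n} \<rightarrow>\<^sub>E {..<q}"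
    unfolding colorings_def by (simp add: G_def complete_bipartite_def)
  have "bij_betw (\<lambda>(f, g). case_sum f g) (SIGMA f : ?A. ?B f) {c \<in> colorings q. proper c}"
  proof (rule bij_betw_byWitness[where f' = "\<lambda>c. (\<lambda>i. c (Inl i), \<lambda>j. c (Inr j))"])
    show "(\<lambda>(f, g). case_sum f g) ` (SIGMA f : ?A. ?B f) \<subseteq> {c \<in> colorings q. proper c}"
    proof clarify
      fix f g assume f: "f \<in> ?A" and g: "g \<in> ?B f"
      have "f i < q \<and> g j < q \<and> f i \<noteq> g j" if "i < m" "j < n" for i j
      proof -
        have "f i \<in> f ` {..<m}" "f i < q" using that f by auto
        moreover have "g j \<notin> f ` {..<m}" "g j < q" using that PiE_mem[OF g, of j] by blast+
        ultimately show ?thesis by metis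
      qed
      then show "case_sum f g \<in> colorings q \<and> proper (case_sum f g)"
        using f g unfolding proper_iff colorings_eq
        by (auto simp: PiE_iff extensional_def image_iff split: sum.split)
    qed
    show "(\<lambda>c. (\<lambda>i. c (Inl i), \<lambda>j. c (Inr j))) ` {c \<in> colorings q. proper c} \<subseteq> (SIGMA f : ?A. ?B f)"
    proof clarify
      fix c assume "c \<in> colorings q" "proper c"
      then show "(\<lambda>i. c (Inl i)) \<in> ?A \<and> (\<lambda>j. c (Inr j)) \<in> ?B (\<lambda>i. c (Inl i))"
        unfolding proper_iff colorings_eq
        by (force simp: PiE_iff extensional_def image_iff)
    qed
  qed (auto simp: fun_eq_iff split: sum.split)
  then have "int (card {c \<in> colorings q. proper c}) = int (card (SIGMA f : ?A. ?B f))"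
    by (simp add: bij_betw_same_card)
  also have "\<dots> = (\<Sum>f\<in>?A. int (card (?B f)))"
    by (subst card_SigmaI) (auto intro!: finite_PiE)
  also have "\<dots> = (\<Sum>f\<in>?A. (\<lambda>k. (int q - int k) ^ n) (card (f ` {..<m})))"
  proof (intro sum.cong refl)
    fix f assume "f \<in> ?A"
    then have "f ` {..<m} \<subseteq> {..<q}" by auto
    moreover from card_mono[OF _ this] have "card (f ` {..<m}) \<le> q" by simp
    ultimately show "int (card (?B f)) = (\<lambda>k. (int q - int k) ^ n) (card (f ` {..<m}))"
      by (simp add: card_PiE card_Diff_subset of_nat_diff)
  qed
  also have "\<dots> = (\<Sum>k\<le>m. of_nat (Stirling m k) * (\<Prod>j<k. int q - int j) * (int q - int k) ^ n)"
    by (rule sum_functions_card_image)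
  finally show ?thesis .
qed

text \<open>The k-th summand of the formula, evaluated at -1/w, is matched with the k-th summand of
  the coloring count; only the powers of w need care.\<close>

lemma h_poly_complete_bipartite:
  assumes "m \<ge> 1" and "linear_order_on (edges (complete_bipartite m n)) r"
  shows "h_poly (complete_bipartite m n) r =
    (\<Sum>k=1..m. (-1) ^ (m + k) * of_nat (Stirling m k) * monom 1 (m - k) *
         (\<Prod>a=1..k-2. [:1, int a:]) * [:1, int (k - 1):] ^ n)" (is "?h = (\<Sum>k=1..m. ?t k)")
proof -
  interpret finite_loopless_graph "complete_bipartite m n"
    by (rule finite_loopless_complete_bipartite)
  have ne: "verts (complete_bipartite m n) \<noteq> {}" using assms(1) by (auto simp: complete_bipartite_def lessThan_empty_iff)
  let ?R = "map_poly rat_of_int"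
  have eval_term: "rat_of_nat q * w ^ (m + n - 1) * poly (?R (?t k)) (- 1 / w) =
      of_nat (Stirling m k) * (\<Prod>j<k. of_nat q - of_nat j) * (of_nat q - of_nat k) ^ n"
    if k: "k \<in> {1..m}" and w: "w = rat_of_nat q - 1" "w \<noteq> 0" for q k w
  proof -
    have R: "poly (?R [:1, int a:]) (- 1 / w) = (w - of_nat a) / w" for a
      using w(2) by (simp add: map_poly_pCons field_simps)
    \<comment> \<open>The exponents m + k and m - k add up to the even number 2m.\<close>
    have sign: "(-1) ^ (m + k) * (- 1 / w) ^ (m - k) = 1 / w ^ (m - k)"
    proof -
      have "(-1) ^ (m + k) * (-1) ^ (m - k) = (1 :: rat)"
        using k by (simp flip: power_add)
      then show ?thesis by (simp only: power_divide times_divide_eq_right)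
    qed
    have "poly (?R (?t k)) (- 1 / w) = ((-1) ^ (m + k) * (- 1 / w) ^ (m - k)) * of_nat (Stirling m k) *
      (\<Prod>a=1..k-2. poly (?R [:1, int a:]) (- 1 / w)) * poly (?R [:1, int (k - 1):]) (- 1 / w) ^ n"
      by (simp add: map_poly_of_int_hom poly_prod poly_power map_poly_monom poly_monom
          map_poly_of_int_of_int[of "int _", simplified] map_poly_of_int_of_int[of "-1", simplified])
    also have "\<dots> = of_nat (Stirling m k) * (\<Prod>a=1..k-2. w - of_nat a) * (of_nat q - of_nat k) ^ n /
       (w ^ (m - k) * w ^ (k - 2) * w ^ n)"
      unfolding sign R using k w(1) by (simp add: prod_dividef power_divide of_nat_diff algebra_simps)
    finally have eq: "poly (?R (?t k)) (- 1 / w) = \<dots>" .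
    have prod: "rat_of_nat q * w ^ (m + n - 1) * (\<Prod>a=1..k-2. w - of_nat a) =
      (w ^ (m - k) * w ^ (k - 2) * w ^ n) * (\<Prod>j<k. of_nat q - of_nat j)"
    \<comment> \<open>For k = 1 the truncated \<open>k - 2\<close> is 0, the falling factorial is
      just q, and all powers of w cancel. For larger k exactly one w is left over and supplies the
      factor q - 1.\<close>
    proof (cases "k = 1")
      case True
      have "m + n - 1 = m - 1 + n" using assms(1) by simp
      then show ?thesis using True by (simp add: power_add)
    next
      case False
      then obtain l where l: "k = Suc (Suc l)" using k by (metis One_nat_def Suc_pred atLeastAtMost_iff le_zero_eq not0_implies_Suc not_less_eq_eq)
      have "m + n - 1 = m - k + l + n + 1" using k l by simp
      then have "w ^ (m + n - 1) = w ^ (m - k) * w ^ (k - 2) * w ^ n * w"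
        by (simp only: power_add l) simp
      moreover have "(\<Prod>a=1..l. w - of_nat a) = (\<Prod>j<l. w - of_nat (Suc j))"
        by (simp add: prod.atLeast1_atMost_eq)
      moreover have "(\<Prod>j<k. rat_of_nat q - of_nat j) = of_nat q * w * (\<Prod>j<l. w - of_nat (Suc j))"
        unfolding l prod.lessThan_Suc_shift w(1) by (simp add: algebra_simps)
      ultimately show ?thesis by (simp add: l)
    qed
    show ?thesis
      using arg_cong[OF prod, of "\<lambda>x. x * of_nat (Stirling m k) * (of_nat q - of_nat k) ^ n"] w(2)
      unfolding eq by (simp add: field_simps)
  qed
  have "poly (?R ?h - ?R (\<Sum>k=1..m. ?t k)) (- 1 / (of_nat q - 1)) = 0" if q: "q \<ge> 2" for q
  proof -
    define w where "w = rat_of_nat q - 1"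
    have w: "w \<noteq> 0" using q by (simp add: w_def)
    have "of_nat q * w ^ (m + n - 1) * poly (?R ?h) (- 1 / w) =
      rat_of_int (int (card {c \<in> colorings q. proper c}))"
      using h_poly_chromatic[OF assms(2) ne q] by (simp add: w_def card_verts_complete_bipartite)
    also have "\<dots> = (\<Sum>k\<le>m. of_nat (Stirling m k) * (\<Prod>j<k. of_nat q - of_nat j) * (of_nat q - of_nat k) ^ n)"
      unfolding chromatic_complete_bipartite by simp
    also have "\<dots> = (\<Sum>k=1..m. of_nat (Stirling m k) * (\<Prod>j<k. of_nat q - of_nat j) * (of_nat q - of_nat k) ^ n)"
    proof -
      \<comment> \<open>The count starts at k = 0, the claimed formula at k = 1: a function on a
        nonempty set has a nonempty image.\<close>
      have "Stirling m 0 = 0" using assms(1) by (cases m) auto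
      then show ?thesis by (intro sum.mono_neutral_right) (auto simp: Suc_le_eq intro: gr0I)
    qed
    also have "\<dots> = (\<Sum>k=1..m. of_nat q * w ^ (m + n - 1) * poly (?R (?t k)) (- 1 / w))"
      by (intro sum.cong refl eval_term[symmetric] w w_def)
    also have "\<dots> = of_nat q * w ^ (m + n - 1) * poly (?R (\<Sum>k=1..m. ?t k)) (- 1 / w)"
      by (simp only: map_poly_of_int_sum poly_sum sum_distrib_left)
    finally show ?thesis using w q by (simp add: w_def)
  qed
  then have "(\<lambda>q. - 1 / (rat_of_nat q - 1)) ` {2..} \<subseteq> {x. poly (?R ?h - ?R (\<Sum>k=1..m. ?t k)) x = 0}"
    by auto
  moreover have "inj_on (\<lambda>q. - 1 / (rat_of_nat q - 1)) {2..}"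
    by (auto simp: inj_on_def divide_simps)
  then have "infinite ((\<lambda>q. - 1 / (rat_of_nat q - 1)) ` {2..})"
    using finite_imageD infinite_Ici by blast
  ultimately have "?R ?h - ?R (\<Sum>k=1..m. ?t k) = 0"
    using poly_roots_finite infinite_super by blast
  then have "?R ?h = ?R (\<Sum>k=1..m. ?t k)" by simp
  then have "coeff (?R ?h) i = coeff (?R (\<Sum>k=1..m. ?t k)) i" for i by simp
  then show ?thesis by (intro poly_eqI) (simp add: coeff_map_poly)
qed

section \<open>Quotients by squarefree monomial ideals\<close>

lemma carrier_mpoly_ring: "p \<in> carrier (mpoly_ring E) \<longleftrightarrow> (\<forall>t\<in>Poly_Mapping.keys p. Poly_Mapping.keys t \<subseteq> E)"
  by (simp add: mpoly_ring_def)

lemma mpoly_ring_simps [simp]: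
  "monoid.mult (mpoly_ring E) = (*)" "one (mpoly_ring E) = 1"
  "ring.zero (mpoly_ring E) = 0" "ring.add (mpoly_ring E) = (+)"
  by (simp_all add: mpoly_ring_def)

lemma keys_uminus: "Poly_Mapping.keys (- p) = Poly_Mapping.keys (p :: 'a \<Rightarrow>\<^sub>0 'b::ab_group_add)"
  by (auto simp: in_keys_iff)

lemma keys_add_nat: "Poly_Mapping.keys (s + t) = Poly_Mapping.keys s \<union> Poly_Mapping.keys (t :: 'a \<Rightarrow>\<^sub>0 nat)"
  by (auto simp: in_keys_iff lookup_add)

lemma carrier_mpoly_ring_closed:
  fixes p q :: "('e, 'k::field) mpoly"
  shows "p \<in> carrier (mpoly_ring E) \<Longrightarrow> q \<in> carrier (mpoly_ring E) \<Longrightarrow> p + q \<in> carrier (mpoly_ring E)"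
    and "p \<in> carrier (mpoly_ring E) \<Longrightarrow> q \<in> carrier (mpoly_ring E) \<Longrightarrow> p * q \<in> carrier (mpoly_ring E)"
    and "p \<in> carrier (mpoly_ring E) \<Longrightarrow> - p \<in> carrier (mpoly_ring E)"
    and "0 \<in> carrier (mpoly_ring E :: ('e, 'k) mpoly ring)" and "1 \<in> carrier (mpoly_ring E :: ('e, 'k) mpoly ring)"
proof -
  assume p: "p \<in> carrier (mpoly_ring E)" and q: "q \<in> carrier (mpoly_ring E)"
  show "p + q \<in> carrier (mpoly_ring E)"
    using p q keys_add[of p q] unfolding carrier_mpoly_ring by blast
  show "p * q \<in> carrier (mpoly_ring E)"
    unfolding carrier_mpoly_ring
  proof
    fix t assume "t \<in> Poly_Mapping.keys (p * q)"
    then obtain a b where "t = a + b" "a \<in> Poly_Mapping.keys p" "b \<in> Poly_Mapping.keys q"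
      using keys_mult[of p q] by blast
    then show "Poly_Mapping.keys t \<subseteq> E"
      using p q by (simp add: carrier_mpoly_ring keys_add_nat)
  qed
qed (simp_all add: carrier_mpoly_ring keys_uminus)

lemma single_in_carrier: "Poly_Mapping.keys t \<subseteq> E \<Longrightarrow> Poly_Mapping.single t c \<in> carrier (mpoly_ring E)"
  by (simp add: carrier_mpoly_ring)

lemma cring_mpoly_ring: "cring (mpoly_ring E :: ('e, 'k::field) mpoly ring)"
proof (rule cringI)
  show "abelian_group (mpoly_ring E :: ('e, 'k::field) mpoly ring)"
  proof (rule abelian_groupI)
    fix x :: "('e, 'k) mpoly"
    assume "x \<in> carrier (mpoly_ring E)"
    then show "\<exists>y\<in>carrier (mpoly_ring E). y \<oplus>\<^bsub>mpoly_ring E\<^esub> x = \<zero>\<^bsub>mpoly_ring E\<^esub>"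
      by (intro bexI[of _ "- x"]) (simp_all add: carrier_mpoly_ring_closed)
  qed (simp_all add: carrier_mpoly_ring_closed ac_simps)
  show "comm_monoid (mpoly_ring E :: ('e, 'k::field) mpoly ring)"
    by (rule comm_monoidI) (simp_all add: carrier_mpoly_ring_closed ac_simps)
qed (simp add: distrib_right)

lemma a_inv_mpoly_ring:
  assumes "p \<in> carrier (mpoly_ring E)"
  shows "\<ominus>\<^bsub>mpoly_ring E\<^esub> p = - (p :: ('e, 'k::field) mpoly)"
proof -
  interpret cring "mpoly_ring E :: ('e, 'k) mpoly ring" by (rule cring_mpoly_ring)
  have "- p \<oplus>\<^bsub>mpoly_ring E\<^esub> p = \<zero>\<^bsub>mpoly_ring E\<^esub>" by simp
  then show ?thesis using assms carrier_mpoly_ring_closed(3)[OF assms] minus_equality by blast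
qed

text \<open>The image of these constants in the quotient is the field over which dimensions are
  taken.\<close>

lemma subfield_Const:
  "subfield (range Const) (mpoly_ring E :: ('e, 'k::field) mpoly ring)"
proof -
  let ?P = "mpoly_ring E :: ('e, 'k) mpoly ring"
  interpret cring ?P by (rule cring_mpoly_ring)
  have carr: "Const c \<in> carrier ?P" for c by (simp add: Const_def carrier_mpoly_ring)
  have Const_mult: "Const a * Const b = (Const (a * b) :: ('e, 'k) mpoly)" for a b
    by (simp add: Const_def mult_single)
  have Const_add: "Const a + Const b = (Const (a + b) :: ('e, 'k) mpoly)" for a b
    by (simp add: Const_def single_add)
  have Const_uminus: "- Const a = (Const (- a) :: ('e, 'k) mpoly)" for a
    by (simp add: Const_def single_uminus)
  have one: "1 = (Const 1 :: ('e, 'k) mpoly)" and zero: "0 = (Const 0 :: ('e, 'k) mpoly)"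
    by (simp_all add: Const_def)
  have Const_eq: "Const a = (Const b :: ('e, 'k) mpoly) \<longleftrightarrow> a = b" for a b
    unfolding Const_def by (metis lookup_single_eq)
  show ?thesis
  proof (rule subfieldI)
    show "subcring (range Const) ?P"
    proof (rule subcringI', rule subringI)
      fix h :: "('e, 'k) mpoly" assume "h \<in> range Const"
      then show "\<ominus>\<^bsub>?P\<^esub> h \<in> range Const"
        using carr by (auto simp: a_inv_mpoly_ring Const_uminus)
    qed (use carr in \<open>auto simp: Const_mult Const_add one\<close>)
    show "Units (?P\<lparr>carrier := range Const\<rparr>) = range Const - {\<zero>\<^bsub>?P\<^esub>}"
    proof (intro equalityI subsetI)
      fix x assume "x \<in> Units (?P\<lparr>carrier := range Const\<rparr>)"
      then show "x \<in> range Const - {\<zero>\<^bsub>?P\<^esub>}"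
        by (auto simp: Units_def Const_mult one zero Const_eq)
    next
      fix x :: "('e, 'k) mpoly" assume "x \<in> range Const - {\<zero>\<^bsub>?P\<^esub>}"
      then obtain c where "x = Const c" "c \<noteq> 0" by (auto simp: zero)
      then show "x \<in> Units (?P\<lparr>carrier := range Const\<rparr>)"
        by (auto simp: Units_def Const_mult one Const_eq intro!: exI[of _ "inverse c"])
    qed
  qed
qed

section \<open>Membership in squarefree monomial ideals\<close>

definition squarefree_mon :: "'e set \<Rightarrow> 'e \<Rightarrow>\<^sub>0 nat" where
  "squarefree_mon B = (\<Sum>e\<in>B. Poly_Mapping.single e 1)"

lemma lookup_squarefree_mon: "finite B \<Longrightarrow> Poly_Mapping.lookup (squarefree_mon B) e = of_bool (e \<in> B)"
  by (simp add: squarefree_mon_def lookup_sum lookup_single when_def)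

lemma keys_squarefree_mon: "finite B \<Longrightarrow> Poly_Mapping.keys (squarefree_mon B) = B"
  by (auto simp: in_keys_iff lookup_squarefree_mon)

lemma prod_Var: "(\<Prod>e\<in>B. Var e :: ('e, 'k::field) mpoly) = Poly_Mapping.single (squarefree_mon B) 1"
  by (induction B rule: infinite_finite_induct) (simp_all add: Var_def squarefree_mon_def mult_single)

lemma sum_single_lookup: "(\<Sum>t\<in>Poly_Mapping.keys p. Poly_Mapping.single t (Poly_Mapping.lookup p t)) = p"
  by (intro poly_mapping_eqI) (auto simp: lookup_sum lookup_single when_def in_keys_iff)

text \<open>Divisibility by a squarefree monomial is inclusion of supports, so membership is tested
  monomial by monomial. The right-hand side is an ideal because multiplication only enlarges
  supports, and each of its monomials is a multiple of a generator.\<close>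

lemma squarefree_monomial_ideal:
  fixes \<B> :: "'e set set"
  assumes "finite E" and sub: "\<And>B. B \<in> \<B> \<Longrightarrow> B \<subseteq> E"
  shows "Idl\<^bsub>mpoly_ring E\<^esub> {\<Prod>e\<in>B. Var e | B. B \<in> \<B>} =
    {p \<in> carrier (mpoly_ring E :: ('e, 'k::field) mpoly ring).
       \<forall>t\<in>Poly_Mapping.keys p. \<exists>B\<in>\<B>. B \<subseteq> Poly_Mapping.keys t}" (is "?I = ?J")
proof (intro equalityI)
  let ?P = "mpoly_ring E :: ('e, 'k) mpoly ring"
  interpret cring ?P by (rule cring_mpoly_ring)
  have fin: "finite B" if "B \<in> \<B>" for B using sub[OF that] assms(1) finite_subset by blast
  have keys_le: "Poly_Mapping.keys (squarefree_mon B) = B" if "B \<in> \<B>" for B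
    by (rule keys_squarefree_mon[OF fin[OF that]])
  have gens: "{\<Prod>e\<in>B. Var e | B. B \<in> \<B>} \<subseteq> carrier ?P"
    using sub keys_le by (auto simp: prod_Var carrier_mpoly_ring)
  have multl: "x * a \<in> ?J" if a: "a \<in> ?J" and x: "x \<in> carrier ?P" for a x
  proof -
    have "\<exists>B\<in>\<B>. B \<subseteq> Poly_Mapping.keys t" if t: "t \<in> Poly_Mapping.keys (x * a)" for t
    proof -
      obtain u v where uv: "t = u + v" "v \<in> Poly_Mapping.keys a"
        using keys_mult[of x a] t by blast
      then obtain B where "B \<in> \<B>" "B \<subseteq> Poly_Mapping.keys v" using a by blast
      then show ?thesis unfolding uv(1) keys_add_nat by blast
    qed
    moreover have "x * a \<in> carrier ?P" using a by (intro carrier_mpoly_ring_closed x) simp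
    ultimately show ?thesis by simp
  qed
  have "ideal ?J ?P"
  proof (rule idealI[OF ring_axioms])
    show "subgroup ?J (add_monoid ?P)"
    proof (rule add.subgroupI)
      show "?J \<noteq> {}" by (auto intro!: exI[of _ 0] simp: carrier_mpoly_ring)
      fix a assume a: "a \<in> ?J"
      then show "\<ominus>\<^bsub>?P\<^esub> a \<in> ?J"
        by (simp add: a_inv_mpoly_ring carrier_mpoly_ring_closed keys_uminus)
      fix b assume "b \<in> ?J"
      then show "a \<oplus>\<^bsub>?P\<^esub> b \<in> ?J"
        using a keys_add[of a b] carrier_mpoly_ring_closed(1)[of a E b] by auto
    qed auto
  qed (use multl in \<open>simp_all add: mult.commute\<close>)
  moreover have "{\<Prod>e\<in>B. Var e | B. B \<in> \<B>} \<subseteq> ?J"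
    using gens keys_le by (auto simp: prod_Var)
  ultimately show "?I \<subseteq> ?J" by (rule genideal_minimal)
  show "?J \<subseteq> ?I"
  proof
    fix p assume p: "p \<in> ?J"
    interpret I: ideal ?I ?P by (rule genideal_ideal[OF gens])
    have single: "Poly_Mapping.single t (Poly_Mapping.lookup p t) \<in> ?I" if t: "t \<in> Poly_Mapping.keys p" for t
    proof -
      obtain B where B: "B \<in> \<B>" "B \<subseteq> Poly_Mapping.keys t" using p t by auto
      \<comment> \<open>The subtraction of exponents truncates, but on \<open>B\<close> every
        exponent of \<open>t\<close> is at least 1.\<close>
      have "t - squarefree_mon B + squarefree_mon B = t"
      proof (rule poly_mapping_eqI)
        fix e
        have "e \<in> B \<Longrightarrow> Poly_Mapping.lookup t e \<ge> 1" using B(2) by (auto simp: in_keys_iff Suc_le_eq)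
        then show "Poly_Mapping.lookup (t - squarefree_mon B + squarefree_mon B) e = Poly_Mapping.lookup t e"
          by (simp add: lookup_add lookup_minus lookup_squarefree_mon[OF fin[OF B(1)]])
      qed
      then have "Poly_Mapping.single t (Poly_Mapping.lookup p t) =
        Poly_Mapping.single (t - squarefree_mon B) (Poly_Mapping.lookup p t) * (\<Prod>e\<in>B. Var e)"
        by (simp add: prod_Var mult_single)
      moreover have "Poly_Mapping.keys (t - squarefree_mon B) \<subseteq> Poly_Mapping.keys t"
        by (auto simp: in_keys_iff lookup_minus)
      then have "Poly_Mapping.single (t - squarefree_mon B) (Poly_Mapping.lookup p t) \<in> carrier ?P"
        using p t by (intro single_in_carrier) (auto simp: carrier_mpoly_ring)
      moreover have "(\<Prod>e\<in>B. Var e) \<in> ?I" using genideal_self[OF gens] B(1) by blast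
      ultimately show ?thesis using I.I_l_closed by fastforce
    qed
    have "(\<Sum>t\<in>T. Poly_Mapping.single t (Poly_Mapping.lookup p t)) \<in> ?I"
      if "finite T" "T \<subseteq> Poly_Mapping.keys p" for T
      using that
    proof (induction T)
      case empty
      then show ?case using I.zero_closed by simp
    next
      case (insert t T)
      then show ?case using I.a_closed[OF single[of t]] by simp
    qed
    from this[OF finite_keys subset_refl] show "p \<in> ?I" unfolding sum_single_lookup .
  qed
qed

section \<open>Counting monomials by support and degree\<close>

lemma finite_monomials_of_degree:
  assumes "finite E"
  shows "finite {t. Poly_Mapping.keys t \<subseteq> E \<and> total_degree t = d}" (is "finite ?S")
proof -
  have "finite (Poly_Mapping.lookup ` ?S)"
  proof (rule finite_subset)
    show "Poly_Mapping.lookup ` ?S \<subseteq> {f. \<forall>x. (x \<in> E \<longrightarrow> f x \<in> {..d}) \<and> (x \<notin> E \<longrightarrow> f x = 0)}"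
    proof (clarsimp, intro conjI allI impI)
      fix t :: "'a \<Rightarrow>\<^sub>0 nat" and x assume t: "Poly_Mapping.keys t \<subseteq> E"
      show "Poly_Mapping.lookup t x \<le> total_degree t"
        unfolding total_degree_def
        by (cases "x \<in> Poly_Mapping.keys t") (auto intro: member_le_sum simp: in_keys_iff)
      show "Poly_Mapping.lookup t x = 0" if "x \<notin> E" using t that by (auto simp: in_keys_iff)
    qed
    show "finite {f. \<forall>x. (x \<in> E \<longrightarrow> f x \<in> {..d}) \<and> (x \<notin> E \<longrightarrow> f x = 0)}"
      by (rule finite_set_of_finite_funs) (auto simp: assms)
  qed
  then show ?thesis by (rule finite_imageD) (auto simp: inj_on_def lookup_inject)
qed

lemma total_degree_add_single:
  assumes "e \<notin> Poly_Mapping.keys s" "i > 0"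
  shows "Poly_Mapping.keys (s + Poly_Mapping.single e i) = insert e (Poly_Mapping.keys s)"
    and "total_degree (s + Poly_Mapping.single e i) = total_degree s + i"
proof -
  show keys: "Poly_Mapping.keys (s + Poly_Mapping.single e i) = insert e (Poly_Mapping.keys s)"
    using assms by (auto simp: keys_add_nat)
  have 0: "Poly_Mapping.lookup s e = 0" using assms(1) by (simp add: in_keys_iff)
  have "(\<Sum>x\<in>Poly_Mapping.keys s. Poly_Mapping.lookup (s + Poly_Mapping.single e i) x) = total_degree s"
    unfolding total_degree_def using assms(1)
    by (intro sum.cong refl) (auto simp: lookup_add lookup_single when_def)
  then show "total_degree (s + Poly_Mapping.single e i) = total_degree s + i"
    unfolding total_degree_def[of "s + _"] keys using assms(1) 0 by (simp add: lookup_add)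
qed

text \<open>Splits off the exponent i of \<open>e\<close>, which is at least 1 because
  \<open>e\<close> lies in the support. The resulting sum is a convolution with z + z^2 +
  ....\<close>

lemma card_monomials_insert:
  assumes "finite F" "e \<notin> F"
  shows "card {t. Poly_Mapping.keys t = insert e F \<and> total_degree t = d} =
    (\<Sum>i\<in>{1..d}. card {s. Poly_Mapping.keys s = F \<and> total_degree s = d - i})"
proof -
  let ?S = "\<lambda>i. {s. Poly_Mapping.keys s = F \<and> total_degree s = d - i}"
  have "bij_betw (\<lambda>(i, s). s + Poly_Mapping.single e i) (SIGMA i : {1..d}. ?S i)
      {t. Poly_Mapping.keys t = insert e F \<and> total_degree t = d}"
  proof (rule bij_betw_byWitness[where
        f' = "\<lambda>t. (Poly_Mapping.lookup t e, t - Poly_Mapping.single e (Poly_Mapping.lookup t e))"])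
    show "\<forall>p\<in>SIGMA i : {1..d}. ?S i. (\<lambda>t. (Poly_Mapping.lookup t e,
        t - Poly_Mapping.single e (Poly_Mapping.lookup t e))) ((\<lambda>(i, s). s + Poly_Mapping.single e i) p) = p"
      using assms(2) by (auto simp: lookup_add in_keys_iff)
    have split: "t - Poly_Mapping.single e (Poly_Mapping.lookup t e) +
        Poly_Mapping.single e (Poly_Mapping.lookup t e) = t" for t :: "'a \<Rightarrow>\<^sub>0 nat"
      by (rule poly_mapping_eqI) (auto simp: lookup_add lookup_minus lookup_single when_def)
    then show "\<forall>t\<in>{t. Poly_Mapping.keys t = insert e F \<and> total_degree t = d}.
        (\<lambda>(i, s). s + Poly_Mapping.single e i)
          (Poly_Mapping.lookup t e, t - Poly_Mapping.single e (Poly_Mapping.lookup t e)) = t"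
      by simp
    show "(\<lambda>(i, s). s + Poly_Mapping.single e i) ` (SIGMA i : {1..d}. ?S i) \<subseteq>
        {t. Poly_Mapping.keys t = insert e F \<and> total_degree t = d}"
      using assms(2) by (auto simp: total_degree_add_single)
    show "(\<lambda>t. (Poly_Mapping.lookup t e, t - Poly_Mapping.single e (Poly_Mapping.lookup t e))) `
        {t. Poly_Mapping.keys t = insert e F \<and> total_degree t = d} \<subseteq> (SIGMA i : {1..d}. ?S i)"
    proof (rule image_subsetI)
      fix t assume "t \<in> {t. Poly_Mapping.keys t = insert e F \<and> total_degree t = d}"
      then have t: "Poly_Mapping.keys t = insert e F" and d: "total_degree t = d" by auto
      let ?i = "Poly_Mapping.lookup t e"
      let ?s = "t - Poly_Mapping.single e ?i"
      have "?i > 0" using t by (metis in_keys_iff insertI1 neq0_conv)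
      moreover have "Poly_Mapping.keys ?s = Poly_Mapping.keys t - {e}"
        by (auto simp: in_keys_iff lookup_minus lookup_single when_def split: if_splits)
      then have s: "Poly_Mapping.keys ?s = F" using t assms(2) by auto
      moreover have "total_degree t = total_degree ?s + ?i"
        using total_degree_add_single(2)[of e ?s ?i] s assms(2) \<open>?i > 0\<close> unfolding split by simp
      ultimately show "(?i, ?s) \<in> (SIGMA i : {1..d}. ?S i)" using d by simp
    qed
  qed
  then have "card {t. Poly_Mapping.keys t = insert e F \<and> total_degree t = d} = card (SIGMA i : {1..d}. ?S i)"
    by (simp add: bij_betw_same_card)
  also have "finite (?S i)" for i
    by (rule finite_subset[OF _ finite_monomials_of_degree[OF assms(1), of "d - i"]]) auto
  then have "card (SIGMA i : {1..d}. ?S i) = (\<Sum>i\<in>{1..d}. card (?S i))"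
    by (intro card_SigmaI) auto
  finally show ?thesis .
qed

text \<open>The base of the power is z/(1-z), given by its coefficients; each element of the support
  contributes one such factor.\<close>

lemma fps_monomials_with_keys:
  assumes "finite F"
  shows "Abs_fps (\<lambda>d. of_nat (card {t. Poly_Mapping.keys t = F \<and> total_degree t = d})) =
    (Abs_fps (\<lambda>i. of_bool (i > 0)) :: rat fps) ^ card F"
  using assms
proof (induction F)
  case empty
  have "{t :: 'a \<Rightarrow>\<^sub>0 nat. Poly_Mapping.keys t = {} \<and> total_degree t = d} = (if d = 0 then {0} else {})" for d
  proof -
    have "Poly_Mapping.keys t = {} \<longleftrightarrow> t = 0" for t :: "'a \<Rightarrow>\<^sub>0 nat"
      by (auto simp: poly_mapping_eq_iff in_keys_iff fun_eq_iff set_eq_iff)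
    then show ?thesis by (auto simp: total_degree_def)
  qed
  then show ?case by (auto simp: fps_eq_iff)
next
  case (insert e F)
  let ?A = "Abs_fps (\<lambda>i. of_bool (i > 0)) :: rat fps"
  have "Abs_fps (\<lambda>d. of_nat (card {t. Poly_Mapping.keys t = insert e F \<and> total_degree t = d})) =
    ?A * Abs_fps (\<lambda>d. of_nat (card {t. Poly_Mapping.keys t = F \<and> total_degree t = d}))"
  proof (rule fps_ext)
    fix d
    have "(\<Sum>i\<in>{1..d}. rat_of_nat (card {s. Poly_Mapping.keys s = F \<and> total_degree s = d - i})) =
      (\<Sum>i=0..d. of_bool (i > 0) * rat_of_nat (card {s. Poly_Mapping.keys s = F \<and> total_degree s = d - i}))"
      by (intro sum.mono_neutral_cong_left) auto
    then show "fps_nth (Abs_fps (\<lambda>d. of_nat (card {t. Poly_Mapping.keys t = insert e F \<and> total_degree t = d}))) d =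
      fps_nth (?A * Abs_fps (\<lambda>d. of_nat (card {t. Poly_Mapping.keys t = F \<and> total_degree t = d}))) d"
      by (simp add: fps_mult_nth card_monomials_insert[OF insert.hyps])
  qed
  then show ?case using insert by simp
qed

section \<open>The basis of standard monomials and the Hilbert series\<close>

locale squarefree_monomial_quotient =
  fixes E :: "'e set" and \<B> :: "'e set set" and K :: "'k::field itself"
  assumes finite_E: "finite E"
    and gens_subset: "\<And>B. B \<in> \<B> \<Longrightarrow> B \<subseteq> E"
    and gens_nonempty: "{} \<notin> \<B>"
begin

abbreviation P :: "('e, 'k) mpoly ring" where "P \<equiv> mpoly_ring E"

definition I :: "('e, 'k) mpoly set" where "I = Idl\<^bsub>P\<^esub> {\<Prod>e\<in>B. Var e | B. B \<in> \<B>}"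

abbreviation res :: "('e, 'k) mpoly \<Rightarrow> ('e, 'k) mpoly set" where "res p \<equiv> I +>\<^bsub>P\<^esub> p"

definition standard :: "('e \<Rightarrow>\<^sub>0 nat) set" where
  "standard = {t. Poly_Mapping.keys t \<subseteq> E \<and> (\<forall>B\<in>\<B>. \<not> B \<subseteq> Poly_Mapping.keys t)}"

lemma mem_I: "p \<in> I \<longleftrightarrow> p \<in> carrier P \<and> Poly_Mapping.keys p \<inter> standard = {}"
proof -
  have "I = {p \<in> carrier P. \<forall>t\<in>Poly_Mapping.keys p. \<exists>B\<in>\<B>. B \<subseteq> Poly_Mapping.keys t}"
    unfolding I_def by (rule squarefree_monomial_ideal[OF finite_E gens_subset])
  moreover have "Poly_Mapping.keys p \<inter> standard = {} \<longleftrightarrow>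
    (\<forall>t\<in>Poly_Mapping.keys p. \<exists>B\<in>\<B>. B \<subseteq> Poly_Mapping.keys t)" if "p \<in> carrier P"
    using that unfolding carrier_mpoly_ring standard_def by blast
  ultimately show ?thesis by blast
qed

sublocale I: ideal I P
proof -
  interpret cring P by (rule cring_mpoly_ring)
  have "p \<in> carrier P" if "B \<in> \<B>" "p = (\<Prod>e\<in>B. Var e)" for B p
    using gens_subset[OF that(1)] finite_subset[OF gens_subset[OF that(1)] finite_E] that(2)
    by (simp add: prod_Var carrier_mpoly_ring keys_squarefree_mon)
  then show "ideal I P" unfolding I_def by (intro genideal_ideal) blast
qed

sublocale res: ring_hom_ring P "P Quot I" res
  by (rule I.rcos_ring_hom_ring)

lemma res_eq_zero_iff: "p \<in> carrier P \<Longrightarrow> res p = \<zero>\<^bsub>P Quot I\<^esub> \<longleftrightarrow> p \<in> I"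
  using I.a_rcos_self[of p] I.a_rcos_const[of p] by (auto simp: FactRing_def)

text \<open>The constants stay a field in the quotient as long as the quotient is nonzero: every
  generator has nonempty support, so the monomial 1 is standard and lies outside
  \<open>I\<close>.\<close>

lemma subfield_res_Const: "subfield (res ` range Const) (P Quot I)"
proof (rule res.img_is_subfield(2)[OF subfield_Const])
  have "(0 :: 'e \<Rightarrow>\<^sub>0 nat) \<in> standard" using gens_nonempty by (auto simp: standard_def)
  then have "1 \<notin> I" by (simp add: mem_I)
  then show "\<one>\<^bsub>P Quot I\<^esub> \<noteq> \<zero>\<^bsub>P Quot I\<^esub>"
    using res_eq_zero_iff[of 1] res.hom_one carrier_mpoly_ring_closed(5)[of E] by auto
qed

lemma res_add: "p \<in> carrier P \<Longrightarrow> q \<in> carrier P \<Longrightarrow> res (p + q) = res p \<oplus>\<^bsub>P Quot I\<^esub> res q"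
  using res.hom_add[of p q] by simp

lemma res_mult: "p \<in> carrier P \<Longrightarrow> q \<in> carrier P \<Longrightarrow> res (p * q) = res p \<otimes>\<^bsub>P Quot I\<^esub> res q"
  using res.hom_mult[of p q] by simp

text \<open>The dimension predicate grows a space by one vector at a time. This is the matching step
  for monomial spans: the coefficient of \<open>t\<close> is split off and the rest is supported on
  \<open>T\<close>.\<close>

lemma line_extension_res:
  assumes "t \<in> standard" "T \<subseteq> standard"
  shows "res ` {p. Poly_Mapping.keys p \<subseteq> insert t T} =
    ring.line_extension (P Quot I) (res ` range Const) (res (Poly_Mapping.single t 1))
      (res ` {p. Poly_Mapping.keys p \<subseteq> T})" (is "?L = ?R")
proof -
  have carr: "p \<in> carrier P" if "Poly_Mapping.keys p \<subseteq> T" for p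
    using that assms by (auto simp: standard_def carrier_mpoly_ring)
  have carr_t: "Poly_Mapping.single t c \<in> carrier P" for c
    using assms(1) by (intro single_in_carrier) (simp add: standard_def)
  have carr_c: "Const c \<in> carrier P" for c by (simp add: Const_def carrier_mpoly_ring)
  have split: "res (Const c) \<otimes>\<^bsub>P Quot I\<^esub> res (Poly_Mapping.single t 1) \<oplus>\<^bsub>P Quot I\<^esub> res p =
    res (Poly_Mapping.single t c + p)" if "Poly_Mapping.keys p \<subseteq> T" for c p
  proof -
    have "Const c * Poly_Mapping.single t 1 = Poly_Mapping.single t c"
      by (simp add: Const_def mult_single)
    then show ?thesis
      using res_mult[OF carr_c carr_t, of c 1] res_add[OF carr_t carr[OF that], of c] by simp
  qed
  have R: "?R = {res (Const c) \<otimes>\<^bsub>P Quot I\<^esub> res (Poly_Mapping.single t 1) \<oplus>\<^bsub>P Quot I\<^esub> res p |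
      c p. Poly_Mapping.keys p \<subseteq> T}"
    unfolding res.S.line_extension_def set_add_def set_mult_def r_coset_def by auto
  have R': "?R = {res (Poly_Mapping.single t c + p) | c p. Poly_Mapping.keys p \<subseteq> T}"
    unfolding R using split by (intro Collect_cong) metis
  show ?thesis
  proof (intro equalityI subsetI)
    fix x assume "x \<in> ?L"
    then obtain p where p: "x = res p" "Poly_Mapping.keys p \<subseteq> insert t T" by auto
    define q where "q = p - Poly_Mapping.single t (Poly_Mapping.lookup p t)"
    have "Poly_Mapping.keys q \<subseteq> T"
      using p(2) by (auto simp: q_def in_keys_iff lookup_minus lookup_single when_def split: if_splits)
    moreover have "p = Poly_Mapping.single t (Poly_Mapping.lookup p t) + q" by (simp add: q_def)
    then have "x = res (Poly_Mapping.single t (Poly_Mapping.lookup p t) + q)"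
      unfolding p(1) by (rule arg_cong)
    ultimately show "x \<in> ?R" unfolding R' by blast
  next
    fix x assume "x \<in> ?R"
    then obtain c p where p: "x = res (Poly_Mapping.single t c + p)" "Poly_Mapping.keys p \<subseteq> T"
      unfolding R' by blast
    have "Poly_Mapping.keys (Poly_Mapping.single t c + p) \<subseteq> insert t T"
      using keys_add[of "Poly_Mapping.single t c" p] p(2) by (auto split: if_splits)
    then show "x \<in> ?L" using p(1) by blast
  qed
qed

text \<open>Independence: if the class of \<open>t\<close> were that of some p supported on
  \<open>T\<close>, their difference would lie in \<open>I\<close> while having the standard
  monomial \<open>t\<close> with coefficient 1.\<close>

lemma dimension_res_span:
  assumes "finite T" "T \<subseteq> standard"
  shows "ring.dimension (P Quot I) (card T) (res ` range Const) (res ` {p. Poly_Mapping.keys p \<subseteq> T})"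
  using assms
proof (induction T)
  case empty
  have "{p :: ('e, 'k) mpoly. Poly_Mapping.keys p \<subseteq> {}} = {0}"
    by (auto simp: poly_mapping_eq_iff in_keys_iff fun_eq_iff)
  moreover have "res 0 = \<zero>\<^bsub>P Quot I\<^esub>" using res.hom_zero by simp
  ultimately show ?case using res.S.dimension.zero_dim by simp
next
  case (insert t T)
  have t: "Poly_Mapping.single t 1 \<in> carrier P"
    using insert.prems by (intro single_in_carrier) (auto simp: standard_def)
  have "res (Poly_Mapping.single t 1) \<notin> res ` {p. Poly_Mapping.keys p \<subseteq> T}"
  proof
    assume "res (Poly_Mapping.single t 1) \<in> res ` {p. Poly_Mapping.keys p \<subseteq> T}"
    then obtain p where p: "Poly_Mapping.keys p \<subseteq> T" "res (Poly_Mapping.single t 1) = res p" by auto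
    have pc: "p \<in> carrier P" using p insert.prems by (auto simp: standard_def carrier_mpoly_ring)
    have "res (Poly_Mapping.single t 1 + - p) = res (p + - p)"
      using res_add[OF t] res_add[OF pc] carrier_mpoly_ring_closed(3)[OF pc] p(2) by metis
    also have "\<dots> = \<zero>\<^bsub>P Quot I\<^esub>" using res.hom_zero by simp
    finally have "Poly_Mapping.single t 1 + - p \<in> I"
      using res_eq_zero_iff[OF carrier_mpoly_ring_closed(1)[OF t carrier_mpoly_ring_closed(3)[OF pc]]] by simp
    moreover have "Poly_Mapping.lookup p t = 0"
      using p(1) insert.hyps(2) by (metis in_keys_iff subsetD)
    then have "t \<in> Poly_Mapping.keys (Poly_Mapping.single t 1 + - p)"
      by (simp add: in_keys_iff lookup_minus)
    ultimately show False using insert.prems by (auto simp: mem_I)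
  qed
  moreover have "res (Poly_Mapping.single t 1) \<in> carrier (P Quot I)"
    using res.hom_closed[OF t] .
  ultimately show ?case
    using res.S.dimension.Suc_dim insert line_extension_res[of t T] by simp
qed

definition standard_deg :: "nat \<Rightarrow> ('e \<Rightarrow>\<^sub>0 nat) set" where
  "standard_deg d = {t \<in> standard. total_degree t = d}"

text \<open>Dropping the nonstandard monomials of a polynomial changes it by an element of
  \<open>I\<close>.\<close>

lemma res_homogeneous:
  "res ` homogeneous_polys E d = res ` {p. Poly_Mapping.keys p \<subseteq> standard_deg d}"
proof (intro equalityI subsetI)
  fix x assume "x \<in> res ` homogeneous_polys E d"
  then obtain p where p: "x = res p" "p \<in> carrier P" "\<And>t. t \<in> Poly_Mapping.keys p \<Longrightarrow> total_degree t = d"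
    by (auto simp: homogeneous_polys_def)
  define q where "q = (\<Sum>t\<in>Poly_Mapping.keys p \<inter> standard. Poly_Mapping.single t (Poly_Mapping.lookup p t))"
  have q: "Poly_Mapping.lookup q t = (if t \<in> standard then Poly_Mapping.lookup p t else 0)" for t
    by (auto simp: q_def lookup_sum lookup_single when_def in_keys_iff)
  have qc: "q \<in> carrier P" and pqc: "p - q \<in> carrier P"
    using p(2) by (auto simp: carrier_mpoly_ring in_keys_iff q lookup_minus split: if_splits)
  have "p - q \<in> I" unfolding mem_I using pqc by (auto simp: in_keys_iff lookup_minus q)
  then have "res p = res q"
    using res_add[OF qc pqc] res_eq_zero_iff[OF pqc] res.hom_closed[OF qc] by simp
  moreover have "Poly_Mapping.keys q \<subseteq> standard_deg d"
    using p(3) by (auto simp: standard_deg_def in_keys_iff q split: if_splits)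
  ultimately show "x \<in> res ` {p. Poly_Mapping.keys p \<subseteq> standard_deg d}" using p(1) by blast
next
  fix x assume "x \<in> res ` {p. Poly_Mapping.keys p \<subseteq> standard_deg d}"
  then show "x \<in> res ` homogeneous_polys E d"
    by (auto simp: homogeneous_polys_def standard_deg_def standard_def carrier_mpoly_ring subset_iff intro!: imageI)
qed

lemma finite_standard_deg: "finite (standard_deg d)"
  by (rule finite_subset[OF _ finite_monomials_of_degree[OF finite_E, of d]])
    (auto simp: standard_deg_def standard_def)

lemma hilbert_series_standard: "hilbert_series E I = Abs_fps (\<lambda>d. of_nat (card (standard_deg d)))"
proof -
  have "ring.dim (P Quot I) (res ` range Const) (res ` homogeneous_polys E d) = card (standard_deg d)" for d
    using res.S.dimI[OF subfield_res_Const dimension_res_span[OF finite_standard_deg[of d]]]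
    by (simp add: res_homogeneous over_def standard_deg_def)
  then show ?thesis by (simp add: hilbert_series_def Let_def)
qed

lemma hilbert_series_eq_sum_faces:
  "hilbert_series E I =
    (\<Sum>F\<in>{F. F \<subseteq> E \<and> (\<forall>B\<in>\<B>. \<not> B \<subseteq> F)}. Abs_fps (\<lambda>i. of_bool (i > 0)) ^ card F)"
  (is "_ = (\<Sum>F\<in>?\<Delta>. _)")
proof -
  have fin: "finite ?\<Delta>" using finite_E by (auto intro: finite_subset[of _ "Pow E"])
  have finF: "finite F" if "F \<in> ?\<Delta>" for F using that finite_E finite_subset by blast
  have "card (standard_deg d) = (\<Sum>F\<in>?\<Delta>. card {t. Poly_Mapping.keys t = F \<and> total_degree t = d})" for d
  proof -
    have "finite {t. Poly_Mapping.keys t = F \<and> total_degree t = d}" if "F \<in> ?\<Delta>" for F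
      by (rule finite_subset[OF _ finite_monomials_of_degree[OF finF[OF that], of d]]) auto
    moreover have "standard_deg d = (\<Union>F\<in>?\<Delta>. {t. Poly_Mapping.keys t = F \<and> total_degree t = d})"
      by (auto simp: standard_deg_def standard_def)
    ultimately show ?thesis using fin by (simp only: , subst card_UN_disjoint) auto
  qed
  then have "hilbert_series E I =
    (\<Sum>F\<in>?\<Delta>. Abs_fps (\<lambda>d. of_nat (card {t. Poly_Mapping.keys t = F \<and> total_degree t = d})))"
    unfolding hilbert_series_standard by (simp add: fps_eq_iff fps_sum_nth)
  also have "\<dots> = (\<Sum>F\<in>?\<Delta>. Abs_fps (\<lambda>i. of_bool (i > 0)) ^ card F)"
    by (intro sum.cong refl fps_monomials_with_keys finF)
  finally show ?thesis .
qed

end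

text \<open>Proved after multiplication by (1-z)^d, where d = |V| - 1. Since A (1-z) = z, a face of
  size i turns into z^i (1-z)^(d-i), its contribution to h; the bound i \<le> d keeps the exponent
  honest. Dividing back is legitimate because (1-z)^d has a nonzero constant term.\<close>

theorem (in finite_loopless_graph) hilbert_series_bc_ideal:
  assumes lin: "linear_order_on (edges G) r" and ne: "verts G \<noteq> {}"
  shows "hilbert_series (edges G) (bc_ideal G r :: ('e, 'k::field) mpoly set) =
    fps_of_poly (map_poly rat_of_int (h_poly G r)) / (1 - fps_X) ^ (card (verts G) - 1)"
proof -
  define d where "d = card (verts G) - 1"
  define A :: "rat fps" where "A = Abs_fps (\<lambda>i. of_bool (i > 0))"
  interpret Q: squarefree_monomial_quotient "edges G" "broken_circuits G r" "TYPE('k)"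
  proof
    show "B \<subseteq> edges G" if "B \<in> broken_circuits G r" for B
      using that cycle_finite by (auto simp: broken_circuits_def)
    show "{} \<notin> broken_circuits G r"
      using empty_in_bc_complex by (auto simp: bc_complex_def)
  qed (rule finite_edges)
  have H: "hilbert_series (edges G) (bc_ideal G r :: ('e, 'k) mpoly set) = (\<Sum>F\<in>bc_complex G r. A ^ card F)"
    using Q.hilbert_series_eq_sum_faces unfolding Q.I_def bc_ideal_def bc_complex_def A_def .
  have A: "A * (1 - fps_X) = fps_X"
    by (rule fps_ext) (auto simp: A_def algebra_simps fps_X_mult_nth)
  have "(\<Sum>F\<in>bc_complex G r. A ^ card F) * (1 - fps_X) ^ d =
    (\<Sum>F\<in>bc_complex G r. fps_X ^ card F * (1 - fps_X) ^ (d - card F))"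
    unfolding sum_distrib_right
  proof (intro sum.cong refl)
    fix F assume "F \<in> bc_complex G r"
    then have "card F \<le> d" using card_bc_face_less[OF lin ne] by (fastforce simp: d_def)
    then have "(1 - fps_X :: rat fps) ^ d = (1 - fps_X) ^ card F * (1 - fps_X) ^ (d - card F)"
      by (simp flip: power_add)
    moreover have "fps_X ^ card F = A ^ card F * (1 - fps_X) ^ card F"
      by (metis A power_mult_distrib)
    ultimately show "A ^ card F * (1 - fps_X) ^ d = fps_X ^ card F * (1 - fps_X) ^ (d - card F)"
      by (simp only: mult.assoc)
  qed
  also have "\<dots> = fps_of_poly (map_poly rat_of_int (h_poly G r))"
  proof -
    have linear: "fps_of_poly [:1, - 1 :: rat:] = 1 - fps_X"
      by (simp add: fps_of_poly_pCons)
    show ?thesis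
      unfolding h_poly_eq_sum_faces[OF lin ne] d_def
      by (simp add: map_poly_of_int_hom map_poly_monom map_poly_pCons fps_of_poly_sum
          fps_of_poly_mult fps_of_poly_power fps_of_poly_monom' linear)
  qed
  finally have eq: "(\<Sum>F\<in>bc_complex G r. A ^ card F) * (1 - fps_X) ^ d =
    fps_of_poly (map_poly rat_of_int (h_poly G r))" .
  have "fps_nth ((1 - fps_X :: rat fps) ^ d) 0 \<noteq> 0" by (simp add: fps_nth_power_0)
  then have "(1 - fps_X :: rat fps) ^ d \<noteq> 0" by (metis fps_zero_nth)
  then show ?thesis unfolding H eq[symmetric] d_def[symmetric] by simp
qed

theorem theorem6p4:
  fixes m n :: nat and r :: "(nat \<times> nat) rel"
  assumes "m \<ge> 1" and "n \<ge> 1"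
    and "linear_order_on (edges (complete_bipartite m n)) r"
  shows "h_poly (complete_bipartite m n) r =
      (\<Sum>k=1..m. (-1) ^ (m + k) * of_nat (Stirling m k) * monom 1 (m - k) *
         (\<Prod>a=1..k-2. [:1, int a:]) * [:1, int (k - 1):] ^ n)
    \<and> hilbert_series (edges (complete_bipartite m n))
        (bc_ideal (complete_bipartite m n) r :: (nat \<times> nat, 'k::field) mpoly set) =
      fps_of_poly (map_poly rat_of_int (h_poly (complete_bipartite m n) r)) /
        (1 - fps_X) ^ (m + n - 1)"
proof
  interpret finite_loopless_graph "complete_bipartite m n"
    by (rule finite_loopless_complete_bipartite)
  show "h_poly (complete_bipartite m n) r =
      (\<Sum>k=1..m. (-1) ^ (m + k) * of_nat (Stirling m k) * monom 1 (m - k) *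
         (\<Prod>a=1..k-2. [:1, int a:]) * [:1, int (k - 1):] ^ n)"
    by (rule h_poly_complete_bipartite[OF assms(1,3)])
  have "verts (complete_bipartite m n) \<noteq> {}"
    using assms(1) by (auto simp: complete_bipartite_def lessThan_empty_iff)
  from hilbert_series_bc_ideal[OF assms(3) this]
  show "hilbert_series (edges (complete_bipartite m n))
        (bc_ideal (complete_bipartite m n) r :: (nat \<times> nat, 'k) mpoly set) =
      fps_of_poly (map_poly rat_of_int (h_poly (complete_bipartite m n) r)) /
        (1 - fps_X) ^ (m + n - 1)"
    by (simp only: card_verts_complete_bipartite)
qed

end
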